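(* Let $X$ be a proper metric space. Then the correspondence assigning to a controlled product on $X$ the Gromov compactification $\overline{X}$ of $X$ with respect to that controlled product induces a (well-defined) bijection from the set of all coarse equivalence classes of controlled products on $X$ to the set of all equivalence classes of coarse compactifications of $X$.
   Context: A metric space is proper if every closed bounded subset is compact. $\mathbb{R}_{\geq 0}$ is the set of non-negative reals and $\mathbb{N}$ the set of positive integers. Controlled product. For a metric space $(X,d)$ and a base point $x_0\in X$, a symmetric function $(\cdot\mid\cdot):X\times X\to\mathbb{R}_{\geq 0}$ is a controlled product on $X$ if: (CP1) there is a non-decreasing $\rho_1:\mathbb{R}_{\geq 0}\to\mathbb{R}_{\geq 0}$ with $\min\{(x\mid y),(y\mid z)\}\leq\rho_1((x\mid z))$ for all $x,y,z\in X$; (CP2) there is a non-decreasing $\rho_2:\mathbb{R}_{\geq 0}\to\mathbb{R}_{\geq 0}$ with $(x\mid y)\leq\rho_2(d(x_0,x))$ for all $x,y\in X$; (CP3) there is a function $\rho_3:\mathbb{R}_{\geq 0}\times\mathbb{R}_{\geq 0}\to\mathbb{R}_{\geq 0}$, non-decreasing in the sense that $\rho_3(s_1,t_1)\leq\rho_3(s_2,t_2)$ whenever $s_1\leq s_2$ and $t_1\leq t_2$, with $d(x_0,x)\leq\rho_3((x\mid y),d(x,y))$ for all $x,y\in X$; (CP4) there is a non-decreasing $\rho_4:\mathbb{R}_{\geq 0}\to\mathbb{R}_{\geq 0}$ such that for every $R\geq 0$ and every $x\in X$ with $d(x_0,x)>\rho_4(R)$ there is $y\in X$ with $d(x_0,y)\leq\rho_4(R)$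 and $(x\mid y)\geq R$. These conditions do not depend on the choice of $x_0\in X$. Coarse equivalence. Two controlled products $(\cdot\mid\cdot)$ and $(\cdot\mid\cdot)'$ on $X$ are coarsely equivalent if there are non-decreasing functions $\rho_-,\rho_+:\mathbb{R}_{\geq 0}\to\mathbb{R}_{\geq 0}$ with $\lim_{t\to\infty}\rho_-(t)=\infty$ and $\rho_-((x\mid y))\leq(x\mid y)'\leq\rho_+((x\mid y))$ for all $x,y\in X$. Gromov compactification. $S_\infty(X)$ is the set of sequences $(x_i)$ in $X$ with $(x_i\mid x_j)\to\infty$ as $i,j\to\infty$. For $(x_i),(y_i)\in S_\infty(X)$ put $(x_i)\sim(y_i)$ iff $(x_i\mid y_i)\to\infty$ as $i\to\infty$; this is an equivalence relation. The Gromov boundary is $\partial X=S_\infty(X)/\sim$, and $\overline{X}=X\cup\partial X$ (disjoint union). For $x\in X$ and a sequence $(x_i)$ in $X$, write $(x_i)\in x$ if $x_i=x$ for all $i$; for $x\in\partial X$, $(x_i)\in x$ means $(x_i)$ belongs to the class $x$. Extend the product to $\overline{X}\times\overline{X}\to\mathbb{R}_{\geq 0}\cup\{\infty\}$ by $(x\mid y)=\inf\{\liminf_{i\to\infty}(x_i\mid y_i):(x_i)\in x,\ (y_i)\in y\}$. For $n\in\mathbb{N}$ let $V_n=\{(x,y)\in\overline{X}\times\overline{X}:(x\mid y)>n\}\cup\{(x,y)\in X\times X:d(x,y)<1/n\}$. The family $\{V_n\}$ is a base of a metrizable uniformity on $\overline{X}$, and $\overline{X}$ carries the induced topology: the sets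 $V_n[x]=\{y\in\overline{X}:(y,x)\in V_n\}$ form a neighbourhood base at $x$. When $X$ is proper and $(\cdot\mid\cdot)$ is a controlled product, $\overline{X}$ is a compactification of $X$, called the Gromov compactification with respect to $(\cdot\mid\cdot)$. Coarse compactification. A bounded continuous function $f:X\to\mathbb{C}$ is a Higson function if for every $\varepsilon>0$ and $R>0$ there is a bounded subset $B\subset X$ such that $|f(x)-f(y)|<\varepsilon$ for all $x,y\in X\setminus B$ with $d(x,y)<R$. The Higson compactification $hX$ is the compactification of $X$ such that $C(hX)$ is naturally isomorphic (by restriction to $X$) to the $C^*$-algebra $C_h(X)$ of all Higson functions. A compactification $cX$ of $X$ is a coarse compactification if it is metrizable and there is a continuous map $f:hX\to cX$ with $f|_X=\mathrm{id}_X$. Two compactifications $c_1X$, $c_2X$ of $X$ are equivalent if there is a homeomorphism $f:c_1X\to c_2X$ with $f|_X=\mathrm{id}_X$. *)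

theory Defs
  imports "HOL-Analysis.Analysis"
begin

section \<open>Controlled products\<close>

text \<open>Non-decreasing functions from the non-negative reals to themselves; the values of the
  underlying function at negative arguments are irrelevant.\<close>

definition control_fun :: "(real \<Rightarrow> real) \<Rightarrow> bool" where
  "control_fun \<rho> \<longleftrightarrow> \<rho> \<in> {0..} \<rightarrow> {0..} \<and> mono_on {0..} \<rho>"

definition CP1 :: "('a \<Rightarrow> 'a \<Rightarrow> real) \<Rightarrow> bool" where
  "CP1 p \<longleftrightarrow> (\<exists>\<rho>. control_fun \<rho> \<and> (\<forall>x y z. min (p x y) (p y z) \<le> \<rho> (p x z)))"

definition CP2 :: "'a::metric_space \<Rightarrow> ('a \<Rightarrow> 'a \<Rightarrow> real) \<Rightarrow> bool" where
  "CP2 x0 p \<longleftrightarrow> (\<exists>\<rho>. control_fun \<rho> \<and> (\<forall>x y. p x y \<le> \<rho> (dist x0 x)))"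

definition CP3 :: "'a::metric_space \<Rightarrow> ('a \<Rightarrow> 'a \<Rightarrow> real) \<Rightarrow> bool" where
  "CP3 x0 p \<longleftrightarrow> (\<exists>\<rho>::real \<Rightarrow> real \<Rightarrow> real.
     (\<forall>s\<ge>0. \<forall>t\<ge>0. \<rho> s t \<ge> 0) \<and>
     (\<forall>s1\<ge>0. \<forall>t1\<ge>0. \<forall>s2\<ge>s1. \<forall>t2\<ge>t1. \<rho> s1 t1 \<le> \<rho> s2 t2) \<and>
     (\<forall>x y. dist x0 x \<le> \<rho> (p x y) (dist x y)))"

definition CP4 :: "'a::metric_space \<Rightarrow> ('a \<Rightarrow> 'a \<Rightarrow> real) \<Rightarrow> bool" where
  "CP4 x0 p \<longleftrightarrow> (\<exists>\<rho>. control_fun \<rho> \<and>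
     (\<forall>R\<ge>0. \<forall>x. dist x0 x > \<rho> R \<longrightarrow> (\<exists>y. dist x0 y \<le> \<rho> R \<and> p x y \<ge> R)))"

definition controlled_product :: "'a::metric_space \<Rightarrow> ('a \<Rightarrow> 'a \<Rightarrow> real) \<Rightarrow> bool" where
  "controlled_product x0 p \<longleftrightarrow>
     (\<forall>x y. p x y \<ge> 0) \<and> (\<forall>x y. p x y = p y x) \<and> CP1 p \<and> CP2 x0 p \<and> CP3 x0 p \<and> CP4 x0 p"

definition controlled_products :: "'a::metric_space \<Rightarrow> ('a \<Rightarrow> 'a \<Rightarrow> real) set" where
  "controlled_products x0 = {p. controlled_product x0 p}"

definition coarsely_equivalent :: "('a \<Rightarrow> 'a \<Rightarrow> real) \<Rightarrow> ('a \<Rightarrow> 'a \<Rightarrow> real) \<Rightarrow> bool" where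
  "coarsely_equivalent p q \<longleftrightarrow>
     (\<exists>\<rho>m \<rho>p. control_fun \<rho>m \<and> control_fun \<rho>p \<and> filterlim \<rho>m at_top at_top \<and>
        (\<forall>x y. \<rho>m (p x y) \<le> q x y \<and> q x y \<le> \<rho>p (p x y)))"

definition coarse_equiv_rel ::
    "'a::metric_space \<Rightarrow> (('a \<Rightarrow> 'a \<Rightarrow> real) \<times> ('a \<Rightarrow> 'a \<Rightarrow> real)) set" where
  "coarse_equiv_rel x0 =
     {(p, q). p \<in> controlled_products x0 \<and> q \<in> controlled_products x0 \<and> coarsely_equivalent p q}"


section \<open>The Gromov compactification\<close>

text \<open>Points of \<open>X\<close> are tagged by \<open>Inl\<close>; a boundary point is tagged by \<open>Inr\<close> and is literally
  an equivalence class, i.e. a set of sequences.\<close>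

type_synonym 'a gromov_point = "'a + (nat \<Rightarrow> 'a) set"

definition S_infinity :: "('a \<Rightarrow> 'a \<Rightarrow> real) \<Rightarrow> (nat \<Rightarrow> 'a) set" where
  "S_infinity p =
     {u. filterlim (\<lambda>(i, j). p (u i) (u j)) at_top (sequentially \<times>\<^sub>F sequentially)}"

definition seq_equiv_rel :: "('a \<Rightarrow> 'a \<Rightarrow> real) \<Rightarrow> ((nat \<Rightarrow> 'a) \<times> (nat \<Rightarrow> 'a)) set" where
  "seq_equiv_rel p =
     {(u, v). u \<in> S_infinity p \<and> v \<in> S_infinity p \<and>
        filterlim (\<lambda>i. p (u i) (v i)) at_top sequentially}"

definition gromov_boundary :: "('a \<Rightarrow> 'a \<Rightarrow> real) \<Rightarrow> (nat \<Rightarrow> 'a) set set" where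
  "gromov_boundary p = S_infinity p // seq_equiv_rel p"

definition gromov_space :: "('a \<Rightarrow> 'a \<Rightarrow> real) \<Rightarrow> 'a gromov_point set" where
  "gromov_space p = range Inl \<union> Inr ` gromov_boundary p"

fun representing_seqs :: "'a gromov_point \<Rightarrow> (nat \<Rightarrow> 'a) set" where
  "representing_seqs (Inl x) = {\<lambda>i. x}"
| "representing_seqs (Inr C) = C"

definition extended_product ::
    "('a \<Rightarrow> 'a \<Rightarrow> real) \<Rightarrow> 'a gromov_point \<Rightarrow> 'a gromov_point \<Rightarrow> ennreal" where
  "extended_product p a b =
     (INF (u, v) \<in> representing_seqs a \<times> representing_seqs b.
        liminf (\<lambda>i. ennreal (p (u i) (v i))))"

definition gromov_entourage ::
    "('a::metric_space \<Rightarrow> 'a \<Rightarrow> real) \<Rightarrow> nat \<Rightarrow> ('a gromov_point \<times> 'a gromov_point) set" where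
  "gromov_entourage p n =
     {(a, b). a \<in> gromov_space p \<and> b \<in> gromov_space p \<and> extended_product p a b > of_nat n} \<union>
     {(Inl x, Inl y) | x y. dist x y < 1 / real n}"

text \<open>The topology induced by the uniformity with base \<open>V 1, V 2, \<dots>\<close>.\<close>

definition gromov_topology ::
    "('a::metric_space \<Rightarrow> 'a \<Rightarrow> real) \<Rightarrow> 'a gromov_point topology" where
  "gromov_topology p =
     topology (\<lambda>U. U \<subseteq> gromov_space p \<and>
       (\<forall>a\<in>U. \<exists>n\<ge>1. {b \<in> gromov_space p. (b, a) \<in> gromov_entourage p n} \<subseteq> U))"

lemma gromov_entourage_antimono:
  assumes "1 \<le> m" "m \<le> n"
  shows "gromov_entourage p n \<subseteq> gromov_entourage p m"
proof -
  have "1 / real n \<le> 1 / real m"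
    using assms by (simp add: frac_le)
  moreover have "(of_nat m :: ennreal) \<le> of_nat n"
    using assms by simp
  ultimately have "(a, b) \<in> gromov_entourage p m" if "(a, b) \<in> gromov_entourage p n" for a b
    using that order.strict_trans1[of "of_nat m :: ennreal" "of_nat n" "extended_product p a b"]
    by (auto simp: gromov_entourage_def)
  then show ?thesis
    by auto
qed

lemma openin_gromov_topology:
  "openin (gromov_topology p) U \<longleftrightarrow> U \<subseteq> gromov_space p \<and>
     (\<forall>a\<in>U. \<exists>n\<ge>1. {b \<in> gromov_space p. (b, a) \<in> gromov_entourage p n} \<subseteq> U)"
proof -
  define N where "N n a = {b \<in> gromov_space p. (b, a) \<in> gromov_entourage p n}" for n a
  define L where "L U \<longleftrightarrow> U \<subseteq> gromov_space p \<and> (\<forall>a\<in>U. \<exists>n\<ge>1. N n a \<subseteq> U)" for U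
  have "L (S \<inter> T)" if S: "L S" and T: "L T" for S T
    unfolding L_def
  proof (intro conjI ballI)
    show "S \<inter> T \<subseteq> gromov_space p" using S by (auto simp: L_def)
    fix a assume a: "a \<in> S \<inter> T"
    obtain m where m: "m \<ge> 1" "N m a \<subseteq> S" using S a by (auto simp: L_def)
    obtain n where n: "n \<ge> 1" "N n a \<subseteq> T" using T a by (auto simp: L_def)
    have "gromov_entourage p (max m n) \<subseteq> gromov_entourage p m"
         "gromov_entourage p (max m n) \<subseteq> gromov_entourage p n"
      using m(1) n(1) by (simp_all add: gromov_entourage_antimono)
    then have "N (max m n) a \<subseteq> N m a" "N (max m n) a \<subseteq> N n a"
      by (auto simp: N_def)
    then show "\<exists>k\<ge>1. N k a \<subseteq> S \<inter> T"
      using m n by (intro exI[of _ "max m n"]) auto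
  qed
  moreover have "L (\<Union>K)" if K: "\<forall>S\<in>K. L S" for K
    unfolding L_def
  proof (intro conjI ballI)
    show "\<Union>K \<subseteq> gromov_space p" using K by (auto simp: L_def)
    fix a assume "a \<in> \<Union>K"
    then obtain S where S: "S \<in> K" "a \<in> S" by (rule UnionE)
    with K have "L S" by simp
    with S(2) obtain n where "n \<ge> 1" "N n a \<subseteq> S" by (auto simp: L_def)
    then show "\<exists>n\<ge>1. N n a \<subseteq> \<Union>K" using S(1) by (intro exI[of _ n]) auto
  qed
  ultimately have "istopology L"
    by (simp add: istopology_def)
  moreover have "gromov_topology p = topology L"
    by (simp add: gromov_topology_def L_def[abs_def] N_def)
  ultimately have "openin (gromov_topology p) U \<longleftrightarrow> L U"
    by (simp add: topology_inverse')
  then show ?thesis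
    by (simp add: L_def N_def)
qed

lemma topspace_gromov_topology [simp]: "topspace (gromov_topology p) = gromov_space p"
proof
  show "topspace (gromov_topology p) \<subseteq> gromov_space p"
    using openin_gromov_topology openin_topspace by blast
  have "openin (gromov_topology p) (gromov_space p)"
    by (auto simp: openin_gromov_topology)
  then show "gromov_space p \<subseteq> topspace (gromov_topology p)"
    by (rule openin_subset)
qed

definition gromov_compactification ::
    "('a::metric_space \<Rightarrow> 'a \<Rightarrow> real) \<Rightarrow> 'a gromov_point topology \<times> ('a \<Rightarrow> 'a gromov_point)" where
  "gromov_compactification p = (gromov_topology p, Inl)"


section \<open>Compactifications\<close>

text \<open>A compactification of the metric space \<open>'a\<close> is a space together with the embedding of
  \<open>'a\<close>; conditions of the form \<open>f|X = id\<close> refer to these embeddings.\<close>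

definition compactification :: "'b topology \<times> ('a::metric_space \<Rightarrow> 'b) \<Rightarrow> bool" where
  "compactification = (\<lambda>(T, e).
     compact_space T \<and> Hausdorff_space T \<and> embedding_map euclidean T e \<and>
     T closure_of (range e) = topspace T)"

definition equivalent_compactifications ::
    "'b topology \<times> ('a \<Rightarrow> 'b) \<Rightarrow> 'c topology \<times> ('a \<Rightarrow> 'c) \<Rightarrow> bool" where
  "equivalent_compactifications = (\<lambda>(T1, e1) (T2, e2).
     \<exists>f. homeomorphic_map T1 T2 f \<and> (\<forall>x. f (e1 x) = e2 x))"

definition higson_function :: "('a::metric_space \<Rightarrow> complex) \<Rightarrow> bool" where
  "higson_function f \<longleftrightarrow> bounded (range f) \<and> continuous_on UNIV f \<and>
     (\<forall>\<epsilon>>0. \<forall>R>0. \<exists>B. bounded B \<and>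
        (\<forall>x\<in>-B. \<forall>y\<in>-B. dist x y < R \<longrightarrow> cmod (f x - f y) < \<epsilon>))"

text \<open>Restriction to \<open>X\<close> identifies \<open>C(H)\<close> with the algebra of Higson functions. Elements of
  \<open>C(H)\<close> are taken extensional, so that they are determined by their values on the space; the
  algebraic operations on both sides are pointwise and hence preserved by restriction.\<close>

definition higson_compactification :: "'b topology \<times> ('a::metric_space \<Rightarrow> 'b) \<Rightarrow> bool" where
  "higson_compactification = (\<lambda>(H, h).
     compactification (H, h) \<and>
     bij_betw (\<lambda>g. g \<circ> h)
       {g \<in> extensional (topspace H). continuous_map H (euclidean :: complex topology) g}
       {f. higson_function f})"

text \<open>The Higson compactification is unique up to equivalence, and for proper \<open>X\<close> it can be
  realised as the closure of the image of \<open>X\<close> under evaluation in the product of copies of the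
  complex plane indexed by the Higson functions. This is why \<open>H\<close> below may be taken to live on
  the type \<open>('a \<Rightarrow> complex) \<Rightarrow> complex\<close>.\<close>

definition coarse_compactification :: "'b topology \<times> ('a::metric_space \<Rightarrow> 'b) \<Rightarrow> bool" where
  "coarse_compactification = (\<lambda>(T, e).
     compactification (T, e) \<and> metrizable_space T \<and>
     (\<exists>(H :: (('a \<Rightarrow> complex) \<Rightarrow> complex) topology) h f.
        higson_compactification (H, h) \<and> continuous_map H T f \<and> (\<forall>x. f (h x) = e x)))"

text \<open>To form a set of equivalence classes, compactifications are taken on a fixed type. Every
  point of a metrizable compactification of \<open>X\<close> is determined by the set of sequences in \<open>X\<close>
  converging to it, so each one has an equivalent copy on \<open>'a gromov_point\<close>.\<close>

definition coarse_compactifications ::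
    "('a::metric_space gromov_point topology \<times> ('a \<Rightarrow> 'a gromov_point)) set" where
  "coarse_compactifications = {c. coarse_compactification c}"

definition compactification_equiv_rel ::
    "(('a::metric_space gromov_point topology \<times> ('a \<Rightarrow> 'a gromov_point)) \<times>
      ('a gromov_point topology \<times> ('a \<Rightarrow> 'a gromov_point))) set" where
  "compactification_equiv_rel =
     {(c1, c2). c1 \<in> coarse_compactifications \<and> c2 \<in> coarse_compactifications \<and>
        equivalent_compactifications c1 c2}"

text \<open>The two relations are equivalence relations.\<close>

lemma control_fun_nonneg: "control_fun \<rho> \<Longrightarrow> t \<ge> 0 \<Longrightarrow> \<rho> t \<ge> 0"
  by (auto simp: control_fun_def)

lemma control_fun_mono: "control_fun \<rho> \<Longrightarrow> 0 \<le> s \<Longrightarrow> s \<le> t \<Longrightarrow> \<rho> s \<le> \<rho> t"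
  by (auto simp: control_fun_def intro: mono_onD)

lemma coarsely_equivalent_sym:
  assumes p: "\<And>x y. p x y \<ge> 0" and q: "\<And>x y. q x y \<ge> 0" and pq: "coarsely_equivalent p q"
  shows "coarsely_equivalent q p"
proof -
  obtain a b where a: "control_fun a" and b: "control_fun b" and lim: "filterlim a at_top at_top"
    and le: "\<And>x y. a (p x y) \<le> q x y" "\<And>x y. q x y \<le> b (p x y)"
    using pq unfolding coarsely_equivalent_def by blast
  define A where "A s = insert 0 {t. t \<ge> 0 \<and> a t \<le> s}" for s
  define B where "B s = {t. t \<ge> 0 \<and> s \<le> b t + t}" for s
  have bddA: "bdd_above (A s)" for s
  proof -
    obtain K where K: "\<And>t. t \<ge> K \<Longrightarrow> a t \<ge> s + 1"
      using lim unfolding filterlim_at_top eventually_at_top_linorder by blast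
    have "t \<le> max 0 K" if "t \<in> A s" for t
      using that K[of t] by (force simp: A_def)
    then show ?thesis by (rule bdd_aboveI)
  qed
  have neB: "max 0 s \<in> B s" for s
    using control_fun_nonneg[OF b, of "max 0 s"] by (auto simp: B_def)
  have bddB: "bdd_below (B s)" for s
    by (rule bdd_belowI[of _ 0]) (auto simp: B_def)
  have "control_fun (\<lambda>s. Sup (A s))"
    unfolding control_fun_def
  proof (intro conjI Pi_I mono_onI)
    show "Sup (A s) \<in> {0..}" for s
      using cSup_upper[OF _ bddA, of 0 s] by (auto simp: A_def)
    show "Sup (A s) \<le> Sup (A t)" if "s \<le> t" for s t
      using that by (intro cSup_subset_mono bddA) (auto simp: A_def)
  qed
  moreover have "control_fun (\<lambda>s. Inf (B s))"
    unfolding control_fun_def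
  proof (intro conjI Pi_I mono_onI)
    have ne: "B s \<noteq> {}" for s using neB by blast
    have "0 \<le> Inf (B s)" for s
      by (rule cInf_greatest[OF ne]) (simp add: B_def)
    then show "Inf (B s) \<in> {0..}" for s
      by simp
    have "B t \<subseteq> B s" if "s \<le> t" for s t
      using that by (auto simp: B_def)
    then show "Inf (B s) \<le> Inf (B t)" if "s \<le> t" for s t
      using that by (intro cInf_superset_mono ne bddB)
  qed
  moreover have "filterlim (\<lambda>s. Inf (B s)) at_top at_top"
    unfolding filterlim_at_top
  proof
    fix Z :: real
    have "Z \<le> Inf (B s)" if s: "s \<ge> b (max 0 Z) + max 0 Z + 1" for s
    proof (rule cInf_greatest)
      show "B s \<noteq> {}" using neB by blast
      fix t assume t: "t \<in> B s"
      show "Z \<le> t"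
      proof (rule ccontr)
        assume "\<not> Z \<le> t"
        then have "b t \<le> b (max 0 Z)" "t \<le> max 0 Z"
          using control_fun_mono[OF b, of t "max 0 Z"] t by (auto simp: B_def)
        then show False using t s by (simp add: B_def)
      qed
    qed
    then show "\<forall>\<^sub>F s in at_top. Z \<le> Inf (B s)"
      unfolding eventually_at_top_linorder by blast
  qed
  moreover have "p x y \<le> Sup (A (q x y))" for x y
    using p le by (intro cSup_upper bddA) (auto simp: A_def)
  moreover have "Inf (B (q x y)) \<le> p x y" for x y
    using p[of x y] le(2)[of x y] by (intro cInf_lower bddB) (auto simp: B_def)
  ultimately show ?thesis
    unfolding coarsely_equivalent_def by blast
qed

lemma coarsely_equivalent_trans:
  assumes p: "\<And>x y. p x y \<ge> 0" and q: "\<And>x y. q x y \<ge> 0"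
    and pq: "coarsely_equivalent p q" and qr: "coarsely_equivalent q r"
  shows "coarsely_equivalent p r"
proof -
  obtain a b where a: "control_fun a" and b: "control_fun b" and lim: "filterlim a at_top at_top"
    and le: "\<And>x y. a (p x y) \<le> q x y" "\<And>x y. q x y \<le> b (p x y)"
    using pq unfolding coarsely_equivalent_def by blast
  obtain a' b' where a': "control_fun a'" and b': "control_fun b'"
    and lim': "filterlim a' at_top at_top"
    and le': "\<And>x y. a' (q x y) \<le> r x y" "\<And>x y. r x y \<le> b' (q x y)"
    using qr unfolding coarsely_equivalent_def by blast
  have "control_fun (g \<circ> f)" if "control_fun f" "control_fun g" for f g
    using that unfolding control_fun_def by (auto simp: Pi_iff mono_on_def)
  then have "control_fun (a' \<circ> a)" "control_fun (b' \<circ> b)"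
    using a a' b b' by blast+
  moreover have "filterlim (a' \<circ> a) at_top at_top"
    unfolding comp_def using filterlim_compose[OF lim' lim] .
  moreover have "(a' \<circ> a) (p x y) \<le> r x y" for x y
    using control_fun_mono[OF a' control_fun_nonneg[OF a p] le(1)] le'(1)
    by (metis comp_apply order_trans)
  moreover have "r x y \<le> (b' \<circ> b) (p x y)" for x y
    using control_fun_mono[OF b' q le(2)] le'(2)
    by (metis comp_apply order_trans)
  ultimately show ?thesis
    unfolding coarsely_equivalent_def by blast
qed

lemma equiv_coarse_equiv_rel: "equiv (controlled_products x0) (coarse_equiv_rel x0)"
proof (rule equivI)
  show "coarse_equiv_rel x0 \<subseteq> controlled_products x0 \<times> controlled_products x0"
    by (auto simp: coarse_equiv_rel_def)
  have "coarsely_equivalent p p" for p :: "'a \<Rightarrow> 'a \<Rightarrow> real"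
    unfolding coarsely_equivalent_def
    by (rule exI[of _ "\<lambda>t. t"], rule exI[of _ "\<lambda>t. t"])
       (auto simp: control_fun_def filterlim_ident intro: mono_onI)
  then show "refl_on (controlled_products x0) (coarse_equiv_rel x0)"
    by (auto simp: refl_on_def coarse_equiv_rel_def)
  show "sym (coarse_equiv_rel x0)"
  proof (rule symI)
    fix p q assume pq: "(p, q) \<in> coarse_equiv_rel x0"
    then have "coarsely_equivalent q p"
      by (intro coarsely_equivalent_sym[of p q])
         (simp_all add: coarse_equiv_rel_def controlled_products_def controlled_product_def)
    then show "(q, p) \<in> coarse_equiv_rel x0"
      using pq by (simp add: coarse_equiv_rel_def)
  qed
  show "trans (coarse_equiv_rel x0)"
  proof (rule transI)
    fix p q r assume pq: "(p, q) \<in> coarse_equiv_rel x0" and qr: "(q, r) \<in> coarse_equiv_rel x0"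
    then have "coarsely_equivalent p r"
      by (intro coarsely_equivalent_trans[of p q r])
         (simp_all add: coarse_equiv_rel_def controlled_products_def controlled_product_def)
    then show "(p, r) \<in> coarse_equiv_rel x0"
      using pq qr by (simp add: coarse_equiv_rel_def)
  qed
qed

lemma equivalent_compactifications_refl: "equivalent_compactifications c c"
  unfolding equivalent_compactifications_def
  by (auto split: prod.split intro!: exI[of _ "\<lambda>x. x"] simp: homeomorphic_map_id[unfolded id_def])

lemma equivalent_compactifications_sym:
  fixes c1 :: "'b topology \<times> ('a::metric_space \<Rightarrow> 'b)"
  assumes c1: "compactification c1" and eq: "equivalent_compactifications c1 c2"
  shows "equivalent_compactifications c2 c1"
proof -
  obtain T1 e1 T2 e2 where c: "c1 = (T1, e1)" "c2 = (T2, e2)" by fastforce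
  then obtain f where f: "homeomorphic_map T1 T2 f" "\<And>x. f (e1 x) = e2 x"
    using eq by (auto simp: equivalent_compactifications_def)
  then obtain g where g: "homeomorphic_maps T1 T2 f g"
    using homeomorphic_map_maps by blast
  have "embedding_map euclidean T1 e1"
    using c1 by (simp add: c compactification_def)
  then have "range e1 = topspace T1 \<inter> range e1"
    unfolding embedding_map_def
    by (metis homeomorphic_imp_surjective_map topspace_euclidean topspace_subtopology)
  then have "e1 x \<in> topspace T1" for x
    by blast
  then have "g (e2 x) = e1 x" for x
    using f(2) g by (metis homeomorphic_maps_def)
  then show ?thesis
    unfolding c equivalent_compactifications_def homeomorphic_map_maps
    using homeomorphic_maps_sym[of T1 T2 f g] g by auto
qed

lemma equivalent_compactifications_trans:
  assumes "equivalent_compactifications c1 c2" "equivalent_compactifications c2 c3"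
  shows "equivalent_compactifications c1 c3"
proof -
  obtain T1 e1 T2 e2 T3 e3 where c: "c1 = (T1, e1)" "c2 = (T2, e2)" "c3 = (T3, e3)" by fastforce
  obtain f g where "homeomorphic_map T1 T2 f" "\<And>x. f (e1 x) = e2 x"
     "homeomorphic_map T2 T3 g" "\<And>x. g (e2 x) = e3 x"
    using assms by (auto simp: c equivalent_compactifications_def)
  then show ?thesis
    unfolding c equivalent_compactifications_def
    by (auto intro!: exI[of _ "g \<circ> f"] homeomorphic_map_compose)
qed

lemma equiv_compactification_equiv_rel:
  "equiv coarse_compactifications
     (compactification_equiv_rel ::
       (('a::metric_space gromov_point topology \<times> ('a \<Rightarrow> 'a gromov_point)) \<times>
        ('a gromov_point topology \<times> ('a \<Rightarrow> 'a gromov_point))) set)"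
    (is "equiv ?C ?r")
proof (rule equivI)
  show "?r \<subseteq> ?C \<times> ?C"
    by (auto simp: compactification_equiv_rel_def)
  show "refl_on ?C ?r"
    by (auto simp: refl_on_def compactification_equiv_rel_def equivalent_compactifications_refl)
  show "sym ?r"
  proof (rule symI)
    fix c1 c2 assume eq: "(c1, c2) \<in> ?r"
    then have "compactification c1"
      by (auto simp: compactification_equiv_rel_def coarse_compactifications_def
          coarse_compactification_def)
    then show "(c2, c1) \<in> ?r"
      using eq equivalent_compactifications_sym[of c1 c2]
      by (simp add: compactification_equiv_rel_def)
  qed
  show "trans ?r"
  proof (rule transI)
    fix c1 c2 c3 assume "(c1, c2) \<in> ?r" "(c2, c3) \<in> ?r"
    then show "(c1, c3) \<in> ?r"
      using equivalent_compactifications_trans[of c1 c2 c3]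
      by (simp add: compactification_equiv_rel_def)
  qed
qed

end

theory Submission
  imports Defs
begin

text \<open>A product \<open>p\<close> is compatible with a compactification if, for sequences \<open>u\<close>, \<open>v\<close> of \<open>X\<close> with limits
  \<open>a\<close>, \<open>b\<close>, the values \<open>p (u i) (v i)\<close> diverge exactly when \<open>a = b\<close> is a boundary point. By
  sequential compactness, two products compatible with the same metrizable compactification are
  coarsely equivalent. A metrizable compactification compatible with \<open>p\<close> is equivalent to the
  Gromov compactification of \<open>p\<close>: a boundary point corresponds to the class of all sequences
  converging to it. Hence it suffices to provide compatible partners in both directions.

  For a controlled product, the sets \<open>{p x y > n} \<union> {dist x y < \<delta>}\<close> contain a base of a metrizable
  uniformity by (CP1)--(CP3), totally bounded by (CP4); the completion is compatible with \<open>p\<close>, and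
  (CP3) makes every continuous function on it restrict to a Higson function. For a coarse
  compactification with metric \<open>D\<close>, the product is
  \<open>1 / (D x y + 1 / (1 + dist x0 x) + 1 / (1 + dist x0 y))\<close>, whose denominator satisfies the
  triangle inequality; (CP3) is the Higson condition for the functions \<open>D a\<close>.\<close>

section \<open>Compatibility of a product with a metrizable compactification\<close>

text \<open>The Gromov entourages are never shown to form a uniformity, and neither compactness nor
  separation is checked on boundary classes: both are imported along a homeomorphism from a metric
  model, where sequences suffice. The obstacle in building that model is the mixed composition of
  \<open>p x y > n\<close> with \<open>dist y z < \<delta>\<close>. Here (CP2) forces points with a
  large product to lie far from \<open>x0\<close>, and far out (CP3) turns a bounded jump into a
  large product, so that only (CP1) remains to be applied. Coarse equivalence is also tested on
  sequences: it suffices that two products diverge along the same sequences of pairs, and the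
  control functions are recovered afterwards as suprema and infima.\<close>

lemma not_filterlim_at_top_subseq:
  fixes f :: "nat \<Rightarrow> real"
  assumes "\<not> filterlim f at_top sequentially"
  shows "\<exists>K r. strict_mono r \<and> (\<forall>i::nat. f (r i) < K)"
proof -
  obtain K where "\<not> (\<forall>\<^sub>F i in sequentially. K \<le> f i)"
    using assms unfolding filterlim_at_top by blast
  then have "infinite {i. f i < K}"
    by (auto simp: eventually_sequentially infinite_nat_iff_unbounded_le not_le)
  then have "strict_mono (enumerate {i. f i < K})" "f (enumerate {i. f i < K} i) < K" for i
    using strict_mono_enumerate enumerate_in_set by blast+
  then show ?thesis by blast
qed

text \<open>The inverse of \<open>e\<close> on its image is continuous, so limits can be carried
  back. This lets sequences with limit \<open>e x\<close> be treated as convergent sequences of the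
  metric space.\<close>

lemma embedding_map_limitin_iff:
  assumes e: "embedding_map X Y e" and x: "x \<in> topspace X" and f: "\<And>i. f i \<in> topspace X"
  shows "limitin Y (\<lambda>i. e (f i)) (e x) F \<longleftrightarrow> limitin X f x F"
proof -
  obtain g where g: "homeomorphic_maps X (subtopology Y (e ` topspace X)) e g"
    using e unfolding embedding_map_def homeomorphic_map_maps by blast
  have "limitin Y (\<lambda>i. e (f i)) (e x) F \<longleftrightarrow>
      limitin (subtopology Y (e ` topspace X)) (\<lambda>i. e (f i)) (e x) F"
    using x f by (simp add: limitin_subtopology)
  also have "\<dots> \<longleftrightarrow> limitin X f x F"
  proof
    assume "limitin (subtopology Y (e ` topspace X)) (\<lambda>i. e (f i)) (e x) F"
    then have "limitin X (g \<circ> (\<lambda>i. e (f i))) (g (e x)) F"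
      using g by (auto simp: homeomorphic_maps_def intro: continuous_map_limit)
    then show "limitin X f x F"
      using g x f by (simp add: homeomorphic_maps_def comp_def)
  next
    assume "limitin X f x F"
    then show "limitin (subtopology Y (e ` topspace X)) (\<lambda>i. e (f i)) (e x) F"
      using g continuous_map_limit[of X _ e f x F] by (auto simp: homeomorphic_maps_def comp_def)
  qed
  finally show ?thesis .
qed

text \<open>Only sequences of \<open>X\<close> and their limits enter, so the notion involves
  neither a metric on \<open>T\<close> nor the extended product, and it survives both homeomorphisms
  and coarse equivalence.\<close>

definition product_compatible :: "('a \<Rightarrow> 'a \<Rightarrow> real) \<Rightarrow> 'b topology \<Rightarrow> ('a \<Rightarrow> 'b) \<Rightarrow> bool" where
  "product_compatible p T e \<longleftrightarrow>
     (\<forall>u v a b. limitin T (\<lambda>i. e (u i)) a sequentially \<longrightarrow> limitin T (\<lambda>i. e (v i)) b sequentially \<longrightarrow>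
        (filterlim (\<lambda>i. p (u i) (v i)) at_top sequentially \<longleftrightarrow> a = b \<and> a \<notin> range e))"

lemma product_compatibleD:
  assumes "product_compatible p T e"
    and "limitin T (\<lambda>i. e (u i)) a sequentially" "limitin T (\<lambda>i. e (v i)) b sequentially"
  shows "filterlim (\<lambda>i. p (u i) (v i)) at_top sequentially \<longleftrightarrow> a = b \<and> a \<notin> range e"
  using assms unfolding product_compatible_def by blast

text \<open>The inverse homeomorphism pulls convergent sequences back to \<open>T\<close>. This is
  used to bring two products onto the same model.\<close>

lemma product_compatible_homeomorphic:
  assumes p: "product_compatible p T e" and f: "homeomorphic_map T T' f"
    and e: "\<And>x. e x \<in> topspace T" and e': "\<And>x. f (e x) = e' x"
  shows "product_compatible p T' e'"
proof -
  obtain g where g: "homeomorphic_maps T T' f g"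
    using f homeomorphic_map_maps by blast
  have ge: "g (e' x) = e x" for x
    using g e[of x] e'[of x] by (metis homeomorphic_maps_def)
  have lim: "limitin T (\<lambda>i. e (u i)) (g a) sequentially" if "limitin T' (\<lambda>i. e' (u i)) a sequentially" for u a
    using continuous_map_limit[of T' T g "\<lambda>i. e' (u i)" a sequentially] g that
    by (simp add: homeomorphic_maps_def comp_def ge)
  have inj: "g a = g b \<longleftrightarrow> a = b" if "a \<in> topspace T'" "b \<in> topspace T'" for a b
    using g that by (metis homeomorphic_maps_def)
  have rng: "g a \<in> range e \<longleftrightarrow> a \<in> range e'" if "a \<in> topspace T'" for a
  proof
    assume "g a \<in> range e"
    then obtain x where "g a = e x" by blast
    then have "a = f (e x)" using g that by (metis homeomorphic_maps_def)
    then show "a \<in> range e'" by (simp add: e')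
  next
    assume "a \<in> range e'"
    then show "g a \<in> range e" using ge by auto
  qed
  show ?thesis
    unfolding product_compatible_def
  proof (intro allI impI)
    fix u v a b assume u: "limitin T' (\<lambda>i. e' (u i)) a sequentially"
      and v: "limitin T' (\<lambda>i. e' (v i)) b sequentially"
    show "filterlim (\<lambda>i. p (u i) (v i)) at_top sequentially \<longleftrightarrow> a = b \<and> a \<notin> range e'"
      using product_compatibleD[OF p lim[OF u] lim[OF v]] inj rng limitin_topspace[OF u]
        limitin_topspace[OF v] by simp
  qed
qed

locale metric_compactification = Metric_space M D for M :: "'b set" and D +
  fixes e :: "'a::metric_space \<Rightarrow> 'b"
  assumes proper: "\<And>S :: 'a set. closed S \<Longrightarrow> bounded S \<Longrightarrow> compact S"
    and compactification: "compactification (mtopology, e)"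
begin

abbreviation conv :: "(nat \<Rightarrow> 'a) \<Rightarrow> 'b \<Rightarrow> bool" where
  "conv u a \<equiv> limitin mtopology (\<lambda>i. e (u i)) a sequentially"

lemma compact_space: "compact_space mtopology"
  and embedding: "embedding_map euclidean mtopology e"
  and dense: "mtopology closure_of (range e) = M"
  using compactification by (auto simp: compactification_def)

lemma continuous_e: "continuous_map euclidean mtopology e"
  using embedding
  unfolding embedding_map_def
  by (rule continuous_map_into_fulltopology[OF homeomorphic_imp_continuous_map])

lemma inj_e: "inj e"
  using embedding homeomorphic_imp_injective_map unfolding embedding_map_def by fastforce

lemma e_in [simp]: "e x \<in> M"
  using continuous_e by (auto simp: continuous_map_def)

lemma conv_iff: "conv u a \<longleftrightarrow> a \<in> M \<and> (\<forall>\<epsilon>>0. \<forall>\<^sub>F i in sequentially. D (e (u i)) a < \<epsilon>)"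
  by (simp add: limitin_metric)

lemma conv_e_iff: "conv u (e x) \<longleftrightarrow> u \<longlonglongrightarrow> x"
  using embedding_map_limitin_iff[OF embedding, of x u sequentially] by simp

lemma conv_unique: "conv u a \<Longrightarrow> conv u b \<Longrightarrow> a = b"
  using limitin_metric_unique by fastforce

lemma conv_subseq: "conv u a \<Longrightarrow> strict_mono r \<Longrightarrow> conv (u \<circ> r) a"
  using limitin_subsequence[of r mtopology "\<lambda>i. e (u i)" a] by (simp add: comp_def)

lemma conv_ex:
  assumes "a \<in> M"
  obtains u where "conv u a"
proof -
  have "a \<in> mtopology closure_of (range e)"
    using assms dense by simp
  then obtain \<sigma> where \<sigma>: "range \<sigma> \<subseteq> range e" "limitin mtopology \<sigma> a sequentially"
    unfolding closure_of_sequentially by auto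
  then have "\<forall>i. \<exists>x. \<sigma> i = e x" by blast
  then obtain u where "\<And>i. \<sigma> i = e (u i)" by metis
  with \<sigma>(2) have "conv u a" by (simp add: limitin_def)
  then show ?thesis by (rule that)
qed

lemma conv_subseq_ex:
  fixes u :: "nat \<Rightarrow> 'a"
  obtains r a where "strict_mono r" "conv (u \<circ> r) a"
proof -
  have "range (\<lambda>i. e (u i)) \<subseteq> M" by auto
  then obtain a r where "strict_mono r" "limitin mtopology ((\<lambda>i. e (u i)) \<circ> r) a sequentially"
    using compact_space[unfolded compact_space_sequentially, rule_format, of "\<lambda>i. e (u i)"] by blast
  then show ?thesis using that[of r a] by (simp add: comp_def)
qed

lemma conv_subseq2_ex:
  fixes u v :: "nat \<Rightarrow> 'a"
  obtains r a b where "strict_mono r" "conv (u \<circ> r) a" "conv (v \<circ> r) b"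
proof -
  obtain r a where r: "strict_mono r" "conv (u \<circ> r) a" by (rule conv_subseq_ex)
  obtain s b where s: "strict_mono s" "conv ((v \<circ> r) \<circ> s) b" by (rule conv_subseq_ex)
  show ?thesis
    using that[of "r \<circ> s" a b] r s conv_subseq[OF r(2) s(1)]
    by (simp add: strict_mono_o comp_assoc)
qed

text \<open>A subsequence staying \<open>\<epsilon>\<close> away from \<open>a\<close> would, by
  compactness, have a further subsequence with a limit other than \<open>a\<close>.\<close>

lemma conv_if_unique:
  assumes "\<And>r a'. strict_mono r \<Longrightarrow> conv (u \<circ> r) a' \<Longrightarrow> a' = a"
  shows "conv u a"
proof -
  have "a \<in> M"
  proof -
    obtain r a' where r: "strict_mono r" "conv (u \<circ> r) a'" by (rule conv_subseq_ex)
    then show ?thesis using assms[OF r] limitin_mspace by blast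
  qed
  moreover have "\<forall>\<^sub>F i in sequentially. D (e (u i)) a < \<epsilon>" if "\<epsilon> > 0" for \<epsilon>
  proof (rule ccontr)
    assume "\<not> ?thesis"
    then have "infinite {i. \<not> D (e (u i)) a < \<epsilon>}"
      by (auto simp: eventually_sequentially infinite_nat_iff_unbounded_le)
    then obtain r :: "nat \<Rightarrow> nat" where r: "strict_mono r" "\<And>i. \<not> D (e (u (r i))) a < \<epsilon>"
      using strict_mono_enumerate enumerate_in_set by blast
    obtain s a' where s: "strict_mono s" "conv ((u \<circ> r) \<circ> s) a'" by (rule conv_subseq_ex)
    then have "a' = a"
      using assms[of "r \<circ> s" a'] r by (simp add: strict_mono_o comp_assoc)
    with s(2) \<open>\<epsilon> > 0\<close> have "\<forall>\<^sub>F i in sequentially. D (e (u (r (s i)))) a < \<epsilon>"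
      by (simp add: conv_iff)
    then show False
      using r(2) by (auto simp: eventually_sequentially)
  qed
  ultimately show ?thesis by (simp add: conv_iff)
qed

lemma locally_compact: "locally_compact_space (euclidean :: 'a topology)"
  unfolding locally_compact_space_def
proof (intro ballI)
  fix x :: 'a
  have "openin euclidean (ball x 1)" "compactin euclidean (cball x 1)"
    using proper[of "cball x 1"] by (auto simp: open_openin[symmetric])
  then show "\<exists>U K. openin euclidean U \<and> compactin euclidean K \<and> x \<in> U \<and> U \<subseteq> K"
    by (intro exI[of _ "ball x 1"] exI[of _ "cball x 1"]) auto
qed

text \<open>Properness makes \<open>X\<close> locally compact, and a dense locally compact subspace
  of a Hausdorff space is open. Hence balls of \<open>X\<close> are neighbourhoods in the
  compactification, as the metric part of the Gromov entourages demands.\<close>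

lemma open_e:
  assumes "open U"
  shows "openin mtopology (e ` U)"
proof -
  have hom: "homeomorphic_map euclidean (subtopology mtopology (range e)) e"
    using embedding by (simp add: embedding_map_def)
  have "locally_compact_space (subtopology mtopology (range e))"
    using locally_compact
      homeomorphic_locally_compact_space[OF homeomorphic_map_imp_homeomorphic_space[OF hom]] by simp
  then have "openin mtopology (range e)"
    by (intro dense_locally_compact_openin_Hausdorff_space) (simp_all add: Hausdorff_space_mtopology dense image_subset_iff)
  moreover have "openin (subtopology mtopology (range e)) (e ` U)"
    using homeomorphic_imp_open_map[OF hom] assms by (auto simp: open_map_def)
  ultimately show ?thesis
    using openin_trans_full by blast
qed

lemma S_infinity_iff:
  assumes p: "product_compatible p mtopology e"
  shows "u \<in> S_infinity p \<longleftrightarrow> (\<exists>a\<in>M - range e. conv u a)"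
proof
  assume "u \<in> S_infinity p"
  then have u: "filterlim (\<lambda>(i, j). p (u i) (u j)) at_top (sequentially \<times>\<^sub>F sequentially)"
    by (simp add: S_infinity_def)
  have eq: "a = b \<and> a \<notin> range e"
    if r: "strict_mono r" "conv (u \<circ> r) a" and s: "strict_mono s" "conv (u \<circ> s) b" for r s a b
  proof -
    \<comment> \<open>Restricting the double limit to the pairs \<open>(r i, s i)\<close> compares
      two subsequential limits; the choice \<open>s = r\<close> later shows that the limit lies off
      \<open>range e\<close>.\<close>
    have "filterlim (\<lambda>i. (r i, s i)) (sequentially \<times>\<^sub>F sequentially) sequentially"
      using r(1) s(1) by (intro filterlim_Pair filterlim_subseq)
    from filterlim_compose[OF u this]
    have "filterlim (\<lambda>i. p ((u \<circ> r) i) ((u \<circ> s) i)) at_top sequentially" by simp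
    then show ?thesis
      using product_compatibleD[OF p r(2) s(2)] by blast
  qed
  obtain r a where r: "strict_mono r" "conv (u \<circ> r) a" by (rule conv_subseq_ex)
  have "conv u a"
    using eq[OF r] by (intro conv_if_unique) metis
  moreover have "a \<notin> range e"
    using eq[OF r r] by blast
  moreover have "a \<in> M"
    using r(2) limitin_mspace by blast
  ultimately show "\<exists>a\<in>M - range e. conv u a" by blast
next
  assume "\<exists>a\<in>M - range e. conv u a"
  then obtain a where a: "a \<notin> range e" "conv u a" by blast
  show "u \<in> S_infinity p"
  proof (rule ccontr)
    assume "u \<notin> S_infinity p"
    then obtain K where K: "\<not> eventually (\<lambda>x. K \<le> (case x of (i, j) \<Rightarrow> p (u i) (u j))) (sequentially \<times>\<^sub>F sequentially)"
      by (auto simp: S_infinity_def filterlim_at_top)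
    \<comment> \<open>Indices are only required to be at least \<open>n\<close>, which already
      preserves limits. A failing double limit thus yields two sequences converging to
      \<open>a\<close> with bounded products.\<close>
    have "\<exists>i\<ge>n. \<exists>j\<ge>n. \<not> K \<le> p (u i) (u j)" for n
      using K unfolding eventually_prod_sequentially by simp blast
    then obtain i j where ij: "\<And>n. i n \<ge> n" "\<And>n. j n \<ge> n" "\<And>n. \<not> K \<le> p (u (i n)) (u (j n))"
      by metis
    have lim: "filterlim k sequentially sequentially" if "\<And>n. k n \<ge> n" for k :: "nat \<Rightarrow> nat"
      using that by (intro filterlim_at_top_mono[OF filterlim_ident]) auto
    have conv: "conv (\<lambda>n. u (k n)) a" if "\<And>n. k n \<ge> n" for k
      using a(2) eventually_compose_filterlim[OF _ lim[OF that]]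
      unfolding conv_iff by blast
    then have "filterlim (\<lambda>n. p (u (i n)) (u (j n))) at_top sequentially"
      using product_compatibleD[OF p conv[OF ij(1)] conv[OF ij(2)]] a(1) by blast
    then show False
      using ij(3) by (auto simp: filterlim_at_top eventually_sequentially)
  qed
qed

lemma seq_equiv_rel_iff:
  assumes p: "product_compatible p mtopology e"
  shows "(u, v) \<in> seq_equiv_rel p \<longleftrightarrow> (\<exists>a\<in>M - range e. conv u a \<and> conv v a)"
proof
  assume "(u, v) \<in> seq_equiv_rel p"
  then obtain a b where a: "a \<in> M - range e" "conv u a" and b: "conv v b"
    and lim: "filterlim (\<lambda>i. p (u i) (v i)) at_top sequentially"
    unfolding seq_equiv_rel_def by (auto simp: S_infinity_iff[OF p])
  then show "\<exists>a\<in>M - range e. conv u a \<and> conv v a"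
    using product_compatibleD[OF p a(2) b] by blast
next
  assume "\<exists>a\<in>M - range e. conv u a \<and> conv v a"
  then obtain a where a: "a \<in> M - range e" "conv u a" "conv v a" by blast
  then have "filterlim (\<lambda>i. p (u i) (v i)) at_top sequentially"
    using product_compatibleD[OF p a(2,3)] by blast
  then show "(u, v) \<in> seq_equiv_rel p"
    using a by (auto simp: seq_equiv_rel_def S_infinity_iff[OF p])
qed

lemma gromov_boundary_eq:
  assumes p: "product_compatible p mtopology e"
  shows "gromov_boundary p = (\<lambda>a. {u. conv u a}) ` (M - range e)"
proof -
  have cls: "seq_equiv_rel p `` {u} = {v. conv v a}" if "a \<in> M - range e" "conv u a" for u a
  proof (intro set_eqI)
    fix v
    show "v \<in> seq_equiv_rel p `` {u} \<longleftrightarrow> v \<in> {v. conv v a}"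
      unfolding Image_singleton_iff seq_equiv_rel_iff[OF p] mem_Collect_eq
      using that conv_unique[OF that(2)] by blast
  qed
  show ?thesis
  proof (intro equalityI subsetI)
    fix C assume "C \<in> gromov_boundary p"
    then obtain u where "u \<in> S_infinity p" "C = seq_equiv_rel p `` {u}"
      unfolding gromov_boundary_def by (rule quotientE)
    then show "C \<in> (\<lambda>a. {u. conv u a}) ` (M - range e)"
      unfolding S_infinity_iff[OF p] using cls by blast
  next
    fix C assume "C \<in> (\<lambda>a. {u. conv u a}) ` (M - range e)"
    then obtain a where a: "a \<in> M - range e" "C = {u. conv u a}" by blast
    then obtain u where u: "conv u a" using conv_ex by blast
    then have "u \<in> S_infinity p" using a S_infinity_iff[OF p] by blast
    then show "C \<in> gromov_boundary p"
      using cls[OF a(1) u] a(2) quotientI unfolding gromov_boundary_def by metis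
  qed
qed

end

section \<open>The Gromov compactification as a model\<close>

lemma eventually_inverse_Suc_less:
  fixes \<eta> :: real
  assumes "\<eta> > 0"
  shows "\<forall>\<^sub>F n in sequentially. 1 / real (Suc n) < \<eta>"
  by (rule order_tendstoD(2)[OF LIMSEQ_Suc[OF lim_1_over_n] assms])

context metric_compactification
begin

lemma conv_inverse_SucI:
  assumes a: "a \<in> M" and z: "\<And>n. D (e (z n)) a < 1 / real (Suc n)"
  shows "conv z a"
  unfolding conv_iff
proof (intro conjI allI impI a)
  fix \<eta> :: real assume "\<eta> > 0"
  then have "\<forall>\<^sub>F n in sequentially. 1 / real (Suc n) < \<eta>"
    by (rule eventually_inverse_Suc_less)
  then show "\<forall>\<^sub>F n in sequentially. D (e (z n)) a < \<eta>"
    by eventually_elim (use z less_trans in blast)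
qed

definition gpoint :: "'b \<Rightarrow> 'a gromov_point" where
  "gpoint a = (if a \<in> range e then Inl (inv e a) else Inr {u. conv u a})"

lemma gpoint_e [simp]: "gpoint (e x) = Inl x"
  by (simp add: gpoint_def inj_e)

lemma gpoint_boundary: "a \<notin> range e \<Longrightarrow> gpoint a = Inr {u. conv u a}"
  by (simp add: gpoint_def)

lemma gpoint_image:
  assumes p: "product_compatible p mtopology e"
  shows "gpoint ` M = gromov_space p"
proof -
  have "gpoint ` M = gpoint ` range e \<union> gpoint ` (M - range e)"
    using e_in by blast
  also have "gpoint ` (M - range e) = Inr ` gromov_boundary p"
    unfolding gromov_boundary_eq[OF p] image_image using gpoint_boundary by (intro image_cong) auto
  finally show ?thesis
    by (simp add: gromov_space_def image_image)
qed

lemma inj_on_gpoint: "inj_on gpoint M"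
proof (rule inj_onI)
  fix a b assume ab: "a \<in> M" "b \<in> M" "gpoint a = gpoint b"
  obtain u where u: "conv u a" by (rule conv_ex[OF ab(1)])
  show "a = b"
  proof (cases "a \<in> range e")
    case True
    then show ?thesis using ab(3) by (auto simp: gpoint_def inj_e split: if_splits)
  next
    case False
    then have "{u. conv u a} = {u. conv u b}"
      using ab(3) by (auto simp: gpoint_def split: if_splits)
    then have "conv u b" using u by blast
    then show ?thesis using conv_unique[OF u] by blast
  qed
qed

text \<open>Only this direction is available at points of \<open>X\<close>: there the constant
  sequence is the sole representative, although other sequences may converge to
  \<open>e x\<close>.\<close>

lemma representing_seqs_gpoint_conv:
  assumes "u \<in> representing_seqs (gpoint a)"
  shows "conv u a"
proof (cases "a \<in> range e")
  case True
  then obtain x where "a = e x" by blast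
  then show ?thesis using assms by simp
next
  case False
  then show ?thesis using assms by (simp add: gpoint_boundary)
qed

lemma representing_seqs_gpoint_nonempty:
  assumes "a \<in> M"
  shows "representing_seqs (gpoint a) \<noteq> {}"
proof (cases "a \<in> range e")
  case True
  then show ?thesis by auto
next
  case False
  obtain u where "conv u a" by (rule conv_ex[OF assms])
  with False show ?thesis by (auto simp: gpoint_boundary)
qed

text \<open>The infimum lies below the liminf for any chosen representatives, so late members of
  these serve as \<open>w\<close> and \<open>z\<close>. This reduces the extended product to points
  of \<open>X\<close>.\<close>

lemma extended_product_greater:
  assumes a: "a \<in> M" and b: "b \<in> M" and \<delta>: "\<delta> > 0"
    and gt: "extended_product p (gpoint b) (gpoint a) > of_nat n"
  shows "\<exists>w z. p w z > real n \<and> D (e w) b < \<delta> \<and> D (e z) a < \<delta>"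
proof -
  obtain u v where u: "u \<in> representing_seqs (gpoint b)" and v: "v \<in> representing_seqs (gpoint a)"
    using representing_seqs_gpoint_nonempty a b by blast
  have "extended_product p (gpoint b) (gpoint a) \<le> liminf (\<lambda>i. ennreal (p (u i) (v i)))"
    unfolding extended_product_def using u v by (intro INF_lower2[of "(u, v)"]) auto
  with gt have "\<forall>\<^sub>F i in sequentially. ennreal (p (u i) (v i)) > of_nat n"
    by (intro less_LiminfD) (rule less_le_trans)
  moreover have "\<forall>\<^sub>F i in sequentially. D (e (u i)) b < \<delta>" "\<forall>\<^sub>F i in sequentially. D (e (v i)) a < \<delta>"
    using representing_seqs_gpoint_conv[OF u] representing_seqs_gpoint_conv[OF v] \<delta>
    by (auto simp: conv_iff)
  ultimately have "\<forall>\<^sub>F i in sequentially. ennreal (p (u i) (v i)) > of_nat n \<and>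
      D (e (u i)) b < \<delta> \<and> D (e (v i)) a < \<delta>"
    by eventually_elim simp
  then obtain i where "ennreal (p (u i) (v i)) > of_nat n" "D (e (u i)) b < \<delta>" "D (e (v i)) a < \<delta>"
    using eventually_happens'[OF sequentially_bot] by blast
  then show ?thesis
    by (intro exI[of _ "u i"] exI[of _ "v i"]) (auto simp: ennreal_less_iff ennreal_of_nat_eq_real_of_nat)
qed

lemma extended_product_not_greater:
  assumes \<delta>: "\<delta> > 0"
    and le: "\<not> extended_product p (gpoint b) (gpoint a) > of_nat n"
  shows "\<exists>w z. p w z < real n + 1 \<and> D (e w) b < \<delta> \<and> D (e z) a < \<delta>"
proof -
  \<comment> \<open>The infimum need not be attained, so the bound is relaxed from \<open>n\<close>
    to \<open>Suc n\<close> in order to select a pair of representatives.\<close>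
  have "extended_product p (gpoint b) (gpoint a) < of_nat (Suc n)"
    using le by (simp add: not_less) (metis add.commute ennreal_of_nat_eq_real_of_nat ennreal_lessI
        le_less_trans lessI of_nat_0_less_iff of_nat_Suc of_nat_less_iff zero_less_Suc)
  then obtain u v where u: "u \<in> representing_seqs (gpoint b)" and v: "v \<in> representing_seqs (gpoint a)"
    and less: "liminf (\<lambda>i. ennreal (p (u i) (v i))) < of_nat (Suc n)"
    unfolding extended_product_def INF_less_iff by auto
  have "\<not> (\<forall>\<^sub>F i in sequentially. of_nat (Suc n) \<le> ennreal (p (u i) (v i)))"
    using less Liminf_bounded[of "of_nat (Suc n)" "\<lambda>i. ennreal (p (u i) (v i))" sequentially] by auto
  \<comment> \<open>A small liminf bounds the product only infinitely often, which still meets the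
    eventual closeness conditions at some index.\<close>
  then have "\<exists>\<^sub>F i in sequentially. ennreal (p (u i) (v i)) < of_nat (Suc n)"
    by (simp add: frequently_def not_less)
  moreover have "\<forall>\<^sub>F i in sequentially. D (e (u i)) b < \<delta>" "\<forall>\<^sub>F i in sequentially. D (e (v i)) a < \<delta>"
    using representing_seqs_gpoint_conv[OF u] representing_seqs_gpoint_conv[OF v] \<delta>
    by (auto simp: conv_iff)
  then have "\<forall>\<^sub>F i in sequentially. D (e (u i)) b < \<delta> \<and> D (e (v i)) a < \<delta>"
    by eventually_elim simp
  ultimately have "\<exists>\<^sub>F i in sequentially. (D (e (u i)) b < \<delta> \<and> D (e (v i)) a < \<delta>) \<and>
      ennreal (p (u i) (v i)) < of_nat (Suc n)"
    using frequently_eventually_frequently by (simp add: conj_commute)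
  then obtain i where i: "ennreal (p (u i) (v i)) < of_nat (Suc n)" "D (e (u i)) b < \<delta>" "D (e (v i)) a < \<delta>"
    using frequently_ex by blast
  then have "p (u i) (v i) < real (Suc n)"
    using ennreal_leI[of "real (Suc n)" "p (u i) (v i)"]
    unfolding ennreal_of_nat_eq_real_of_nat by (meson leD leI)
  then show ?thesis
    using i by (intro exI[of _ "u i"] exI[of _ "v i"]) auto
qed

text \<open>Points \<open>b n\<close> with growing extended product but far from \<open>a\<close>
  would give nearby points \<open>w n\<close> of \<open>X\<close>, and \<open>z n\<close> tending to
  \<open>a\<close>, with diverging products; a subsequence of \<open>w\<close> then tends to
  \<open>a\<close> too. The metric part of the entourage concerns only points of \<open>X\<close>
  and follows from continuity of \<open>e\<close>.\<close>

lemma entourage_imp_near: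
  assumes p: "product_compatible p mtopology e" and a: "a \<in> M" and \<epsilon>: "\<epsilon> > 0"
  shows "\<exists>n\<ge>1. \<forall>b\<in>M. (gpoint b, gpoint a) \<in> gromov_entourage p n \<longrightarrow> D b a < \<epsilon>"
proof -
  have near: "\<exists>N. \<forall>n\<ge>N. \<forall>b\<in>M. extended_product p (gpoint b) (gpoint a) > of_nat n \<longrightarrow> D b a < \<epsilon>"
  proof (rule ccontr)
    assume "\<not> ?thesis"
    then have "\<forall>N. \<exists>n b. n \<ge> N \<and> b \<in> M \<and> extended_product p (gpoint b) (gpoint a) > of_nat n \<and> \<not> D b a < \<epsilon>"
      by blast
    then obtain m b where b: "\<And>n. m n \<ge> n" "\<And>n. b n \<in> M"
      "\<And>n. extended_product p (gpoint (b n)) (gpoint a) > of_nat (m n)" "\<And>n. \<not> D (b n) a < \<epsilon>"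
      by metis
    have "\<exists>w z. p w z > real (m n) \<and> D (e w) (b n) < 1 / Suc n \<and> D (e z) a < 1 / Suc n" for n
      using extended_product_greater[OF a b(2) _ b(3), of "1 / Suc n" n] by simp
    then obtain w z where w: "\<And>n. p (w n) (z n) > real (m n)" "\<And>n. D (e (w n)) (b n) < 1 / Suc n"
      and z: "\<And>n. D (e (z n)) a < 1 / Suc n"
      by metis
    have "conv z a"
      using a z by (rule conv_inverse_SucI)
    obtain r c where r: "strict_mono r" "conv (w \<circ> r) c" by (rule conv_subseq_ex)
    have "filterlim (\<lambda>n. p (w n) (z n)) at_top sequentially"
    proof (rule filterlim_at_top_mono[OF filterlim_real_sequentially], rule always_eventually, rule allI)
      show "real n \<le> p (w n) (z n)" for n
        using w(1)[of n] b(1)[of n] by linarith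
    qed
    then have "filterlim (\<lambda>n. p ((w \<circ> r) n) ((z \<circ> r) n)) at_top sequentially"
      using filterlim_compose[OF _ filterlim_subseq[OF r(1)]] by fastforce
    then have "c = a"
      using product_compatibleD[OF p r(2) conv_subseq[OF \<open>conv z a\<close> r(1)]] by blast
    then have "\<forall>\<^sub>F n in sequentially. D (e (w (r n))) a < \<epsilon> / 2"
      using r(2) half_gt_zero[OF \<epsilon>] unfolding conv_iff comp_def by blast
    moreover have "\<forall>\<^sub>F n in sequentially. 1 / Suc (r n) < \<epsilon> / 2"
      using eventually_subseq[OF r(1) eventually_inverse_Suc_less[of "\<epsilon> / 2"]] \<epsilon> by simp
    ultimately have "\<forall>\<^sub>F n in sequentially. False"
    proof eventually_elim
      case (elim n)
      have "D (b (r n)) a \<le> D (e (w (r n))) (b (r n)) + D (e (w (r n))) a"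
        using a b(2) by (intro triangle'') auto
      then show False using elim w(2)[of "r n"] b(4)[of "r n"] by linarith
    qed
    then show False by simp
  qed
  then obtain N where N: "\<And>n b. n \<ge> N \<Longrightarrow> b \<in> M \<Longrightarrow>
      extended_product p (gpoint b) (gpoint a) > of_nat n \<Longrightarrow> D b a < \<epsilon>"
    by blast
  have "\<exists>N. \<forall>n\<ge>N. \<forall>y x. dist y x < 1 / real n \<longrightarrow> gpoint a = Inl x \<longrightarrow> D (e y) a < \<epsilon>"
  proof (cases "a \<in> range e")
    case True
    then obtain x where x: "a = e x" by blast
    have "open {y. e y \<in> mball (e x) \<epsilon>}"
      using openin_continuous_map_preimage[OF continuous_e openin_mball, of "e x" \<epsilon>] by simp
    then obtain \<delta> where "\<delta> > 0" and \<delta>: "\<And>y. dist y x < \<delta> \<Longrightarrow> e y \<in> mball (e x) \<epsilon>"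
      unfolding open_dist using \<epsilon> by fastforce
    obtain N where N: "1 / Suc N < \<delta>"
      by (rule nat_approx_posE[OF \<open>\<delta> > 0\<close>])
    have "D (e y) a < \<epsilon>" if n: "n \<ge> Suc N" and y: "dist y x' < 1 / real n" "gpoint a = Inl x'" for n y x'
    proof -
      have "1 / real n \<le> 1 / Suc N" using n by (simp add: frac_le)
      then have "dist y x < \<delta>" using N y x by simp
      from \<delta>[OF this] show ?thesis using x by (simp add: commute)
    qed
    then show ?thesis by (intro exI[of _ "Suc N"] allI impI)
  next
    case False
    then show ?thesis by (simp add: gpoint_boundary)
  qed
  then obtain N' where N': "\<And>n y x. n \<ge> N' \<Longrightarrow> dist y x < 1 / real n \<Longrightarrow> gpoint a = Inl x \<Longrightarrow> D (e y) a < \<epsilon>"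
    by blast
  define n where "n = max 1 (max N N')"
  have "D b a < \<epsilon>" if b: "b \<in> M" "(gpoint b, gpoint a) \<in> gromov_entourage p n" for b
  proof (cases "extended_product p (gpoint b) (gpoint a) > of_nat n")
    case True
    then show ?thesis using N[of n b] b by (simp add: n_def)
  next
    case False
    then obtain y x where "gpoint b = Inl y" "gpoint a = Inl x" "dist y x < 1 / real n"
      using b(2) by (auto simp: gromov_entourage_def)
    moreover then have "b = e y"
      by (auto simp: gpoint_def f_inv_into_f split: if_splits)
    ultimately show ?thesis using N'[of n y x] by (simp add: n_def)
  qed
  then show ?thesis by (intro exI[of _ n]) (auto simp: n_def)
qed

lemma near_imp_entourage:
  assumes p: "product_compatible p mtopology e" and a: "a \<in> M" and n: "n \<ge> 1"
  shows "\<exists>\<epsilon>>0. \<forall>b\<in>M. D b a < \<epsilon> \<longrightarrow> (gpoint b, gpoint a) \<in> gromov_entourage p n"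
proof (cases "a \<in> range e")
  case True
  then obtain x where x: "a = e x" by blast
  \<comment> \<open>Around a point of \<open>X\<close> the metric part of the entourage alone
    contains a neighbourhood.\<close>
  have "openin mtopology (e ` ball x (1 / real n))" by (simp add: open_e)
  moreover have "a \<in> e ` ball x (1 / real n)" using x n by simp
  ultimately obtain \<epsilon> where "\<epsilon> > 0" and \<epsilon>: "mball a \<epsilon> \<subseteq> e ` ball x (1 / real n)"
    unfolding openin_mtopology by blast
  have "(gpoint b, gpoint a) \<in> gromov_entourage p n" if b: "b \<in> M" "D b a < \<epsilon>" for b
  proof -
    have "b \<in> e ` ball x (1 / real n)" using \<epsilon> b a commute by auto
    then obtain y where "b = e y" "dist x y < 1 / real n" by auto
    then show ?thesis by (auto simp: x gromov_entourage_def dist_commute)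
  qed
  then show ?thesis using \<open>\<epsilon> > 0\<close> by blast
next
  case False
  show ?thesis
  proof (rule ccontr)
    assume "\<not> ?thesis"
    \<comment> \<open>At a boundary point, \<open>b k\<close> tending to \<open>a\<close> outside
      the entourage would allow approximating points \<open>w k\<close> and \<open>z k\<close> with
      bounded products, both tending to \<open>a\<close>.\<close>
    then have "\<exists>b\<in>M. D b a < 1 / Suc k \<and> (gpoint b, gpoint a) \<notin> gromov_entourage p n" for k
      by (metis of_nat_0_less_iff zero_less_Suc zero_less_divide_1_iff)
    then obtain b where b: "\<And>k. b k \<in> M" "\<And>k. D (b k) a < 1 / Suc k"
      "\<And>k. (gpoint (b k), gpoint a) \<notin> gromov_entourage p n"
      by metis
    have "gpoint (b k) \<in> gromov_space p" "gpoint a \<in> gromov_space p" for k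
      using gpoint_image[OF p] a b(1) by blast+
    then have np: "\<not> extended_product p (gpoint (b k)) (gpoint a) > of_nat n" for k
      using b(3)[of k] by (auto simp: gromov_entourage_def)
    have "\<exists>w z. p w z < real n + 1 \<and> D (e w) (b k) < 1 / Suc k \<and> D (e z) a < 1 / Suc k" for k
      using extended_product_not_greater[OF _ np, of "1 / Suc k" k] by simp
    then obtain w z where wz: "\<And>k. p (w k) (z k) < real n + 1"
      and w: "\<And>k. D (e (w k)) (b k) < 1 / Suc k" and z: "\<And>k. D (e (z k)) a < 1 / Suc k"
      by metis
    have "conv z a"
      using a z by (rule conv_inverse_SucI)
    moreover have "conv w a"
      unfolding conv_iff
    proof (intro conjI allI impI a)
      fix \<eta> :: real assume "\<eta> > 0"
      then have "\<forall>\<^sub>F k in sequentially. 1 / Suc k < \<eta> / 2"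
        by (intro eventually_inverse_Suc_less) simp
      then show "\<forall>\<^sub>F k in sequentially. D (e (w k)) a < \<eta>"
      proof eventually_elim
        case (elim k)
        have "D (e (w k)) a \<le> D (e (w k)) (b k) + D (b k) a"
          using triangle a b(1) by simp
        then show ?case using elim w[of k] b(2)[of k] by linarith
      qed
    qed
    ultimately have "filterlim (\<lambda>k. p (w k) (z k)) at_top sequentially"
      using product_compatibleD[OF p] False by blast
    then have "\<forall>\<^sub>F k in sequentially. real n + 1 \<le> p (w k) (z k)"
      by (simp add: filterlim_at_top)
    then have "\<forall>\<^sub>F k in sequentially. False"
      using wz by (auto simp: not_le[symmetric])
    then show False by simp
  qed
qed

text \<open>Both topologies define openness pointwise by neighbourhoods, and the two preceding
  lemmas compare these. Testing openness on preimages makes \<open>gpoint\<close> a quotient map,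
  and injectivity upgrades it to a homeomorphism.\<close>

lemma homeomorphic_map_gpoint:
  assumes p: "product_compatible p mtopology e"
  shows "homeomorphic_map mtopology (gromov_topology p) gpoint"
proof -
  have "openin (gromov_topology p) U \<longleftrightarrow> openin mtopology {a \<in> M. gpoint a \<in> U}"
    if U: "U \<subseteq> gromov_space p" for U
  proof
    assume L: "openin (gromov_topology p) U"
    show "openin mtopology {a \<in> M. gpoint a \<in> U}"
      unfolding openin_mtopology
    proof (intro conjI allI impI)
      fix a assume a: "a \<in> {a \<in> M. gpoint a \<in> U}"
      then obtain n where "n \<ge> 1" and n: "{b \<in> gromov_space p. (b, gpoint a) \<in> gromov_entourage p n} \<subseteq> U"
        using L unfolding openin_gromov_topology by blast
      obtain \<epsilon> where "\<epsilon> > 0" "\<forall>b\<in>M. D b a < \<epsilon> \<longrightarrow> (gpoint b, gpoint a) \<in> gromov_entourage p n"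
        using near_imp_entourage[OF p _ \<open>n \<ge> 1\<close>] a by blast
      then show "\<exists>\<epsilon>>0. mball a \<epsilon> \<subseteq> {a \<in> M. gpoint a \<in> U}"
        using n gpoint_image[OF p, symmetric] by (intro exI[of _ \<epsilon>]) (auto simp: commute)
    qed auto
  next
    assume R: "openin mtopology {a \<in> M. gpoint a \<in> U}"
    show "openin (gromov_topology p) U"
      unfolding openin_gromov_topology
    proof (intro conjI ballI U)
      fix c assume "c \<in> U"
      then obtain a where a: "a \<in> M" "c = gpoint a" using U gpoint_image[OF p] by blast
      then obtain \<epsilon> where "\<epsilon> > 0" and \<epsilon>: "mball a \<epsilon> \<subseteq> {a \<in> M. gpoint a \<in> U}"
        using R \<open>c \<in> U\<close> unfolding openin_mtopology by blast
      obtain n where "n \<ge> 1" "\<forall>b\<in>M. (gpoint b, gpoint a) \<in> gromov_entourage p n \<longrightarrow> D b a < \<epsilon>"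
        using entourage_imp_near[OF p a(1) \<open>\<epsilon> > 0\<close>] by blast
      moreover have "gpoint b \<in> U" if "b \<in> M" "D b a < \<epsilon>" for b
      proof -
        have "b \<in> mball a \<epsilon>" using that a(1) by (simp add: commute)
        then show ?thesis using \<epsilon> by blast
      qed
      ultimately show "\<exists>n\<ge>1. {b \<in> gromov_space p. (b, c) \<in> gromov_entourage p n} \<subseteq> U"
        using a unfolding gpoint_image[OF p, symmetric] by blast
    qed
  qed
  then have "quotient_map mtopology (gromov_topology p) gpoint"
    unfolding quotient_map_def by (simp add: gpoint_image[OF p])
  then show ?thesis
    using inj_on_gpoint by (simp add: homeomorphic_map_def)
qed

lemma equivalent_gromov_compactification:
  assumes p: "product_compatible p mtopology e"
  shows "equivalent_compactifications (mtopology, e) (gromov_compactification p)"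
  using homeomorphic_map_gpoint[OF p]
  unfolding equivalent_compactifications_def gromov_compactification_def by auto

end

section \<open>Products defined by a compactification\<close>

lemma control_fun_majorant:
  fixes f g :: "'i \<Rightarrow> real"
  assumes "\<And>s. \<exists>K. \<forall>i. g i \<le> s \<longrightarrow> f i \<le> K"
  obtains \<rho> where "control_fun \<rho>" "\<And>i. f i \<le> \<rho> (g i)"
proof -
  \<comment> \<open>Suprema over growing sublevel sets of \<open>g\<close> are monotone; inserting 0
    keeps the set nonempty and the supremum non-negative.\<close>
  define A where "A s = insert 0 (f ` {i. g i \<le> s})" for s
  have bdd: "bdd_above (A s)" for s
  proof -
    obtain K where "\<forall>i. g i \<le> s \<longrightarrow> f i \<le> K" using assms by blast
    then show ?thesis unfolding A_def by (intro bdd_aboveI[of _ "max 0 K"]) (auto simp: le_max_iff_disj)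
  qed
  show ?thesis
  proof
    show "control_fun (\<lambda>s. Sup (A s))"
      unfolding control_fun_def
    proof (intro conjI Pi_I mono_onI)
      show "Sup (A s) \<in> {0..}" for s
        using cSup_upper[OF _ bdd, of 0 s] by (auto simp: A_def)
      show "Sup (A s) \<le> Sup (A t)" if "s \<le> t" for s t
        using that by (intro cSup_subset_mono bdd) (auto simp: A_def)
    qed
    show "f i \<le> Sup (A (g i))" for i
      by (intro cSup_upper bdd) (auto simp: A_def)
  qed
qed

lemma control_fun_divergent_minorant:
  fixes f g :: "'i \<Rightarrow> real"
  assumes nonneg: "\<And>i. f i \<ge> 0" and div: "\<And>K. \<exists>s. \<forall>i. g i \<ge> s \<longrightarrow> f i \<ge> K"
  obtains \<rho> where "control_fun \<rho>" "filterlim \<rho> at_top at_top" "\<And>i. \<rho> (g i) \<le> f i"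
proof -
  \<comment> \<open>The ray keeps the set nonempty when no \<open>g i\<close> reaches
    \<open>s\<close>, and its lower end grows with \<open>s\<close>, so it does not spoil divergence
    of the infimum.\<close>
  define A where "A s = {max 0 s..} \<union> f ` {i. g i \<ge> s}" for s :: real
  have ne: "A s \<noteq> {}" for s by (auto simp: A_def)
  have nn: "t \<ge> 0" if "t \<in> A s" for s t
    using that nonneg by (auto simp: A_def)
  have bdd: "bdd_below (A s)" for s
    using nn by (rule bdd_belowI)
  show ?thesis
  proof
    show "control_fun (\<lambda>s. Inf (A s))"
      unfolding control_fun_def
    proof (intro conjI Pi_I mono_onI)
      show "Inf (A s) \<in> {0..}" for s
        using cInf_greatest[OF ne nn] by simp
      show "Inf (A s) \<le> Inf (A t)" if "s \<le> t" for s t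
        using that by (intro cInf_superset_mono ne bdd) (auto simp: A_def)
    qed
    show "filterlim (\<lambda>s. Inf (A s)) at_top at_top"
      unfolding filterlim_at_top
    proof
      fix K
      obtain s where s: "\<forall>i. g i \<ge> s \<longrightarrow> f i \<ge> K" using div by blast
      have "K \<le> Inf (A t)" if "t \<ge> max s K" for t
        using that s by (intro cInf_greatest ne) (auto simp: A_def)
      then show "\<forall>\<^sub>F t in at_top. K \<le> Inf (A t)"
        unfolding eventually_at_top_linorder by blast
    qed
    show "Inf (A (g i)) \<le> f i" for i
      by (intro cInf_lower bdd) (auto simp: A_def)
  qed
qed

text \<open>Since \<open>P\<close> survives decreasing \<open>R\<close> and increasing
  \<open>r\<close>, choices at natural numbers suffice; partial sums of the non-negative choices are
  monotone and dominate each of them. This produces the control function of (CP4).\<close>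

lemma control_fun_choice:
  fixes P :: "real \<Rightarrow> real \<Rightarrow> bool"
  assumes ex: "\<And>R. R \<ge> 0 \<Longrightarrow> \<exists>r\<ge>0. P R r"
    and mono: "\<And>R R' r r'. P R r \<Longrightarrow> 0 \<le> R' \<Longrightarrow> R' \<le> R \<Longrightarrow> r \<le> r' \<Longrightarrow> P R' r'"
  shows "\<exists>\<rho>. control_fun \<rho> \<and> (\<forall>R\<ge>0. P R (\<rho> R))"
proof -
  have "\<forall>n. \<exists>r\<ge>0. P (real n) r" using ex by simp
  then obtain r where r: "\<And>n. r n \<ge> 0" "\<And>n. P (real n) (r n)" by metis
  show ?thesis
  proof (intro exI conjI allI impI)
    show "control_fun (\<lambda>R. \<Sum>k\<le>nat \<lceil>R\<rceil>. r k)"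
      unfolding control_fun_def
      by (auto intro!: mono_onI sum_nonneg sum_mono2 r nat_mono ceiling_mono)
    show "P R (\<Sum>k\<le>nat \<lceil>R\<rceil>. r k)" if "R \<ge> 0" for R
    proof (rule mono[OF r(2)[of "nat \<lceil>R\<rceil>"] that])
      show "R \<le> real (nat \<lceil>R\<rceil>)" by (rule real_nat_ceiling_ge)
      show "r (nat \<lceil>R\<rceil>) \<le> (\<Sum>k\<le>nat \<lceil>R\<rceil>. r k)"
        using r(1) by (intro member_le_sum) auto
    qed
  qed
qed

text \<open>If no threshold on \<open>f\<close> forced \<open>g\<close> above \<open>K\<close>, one
  violating pair for each natural number would give sequences along which \<open>f\<close> diverges
  and \<open>g\<close> does not. Used in both directions, this yields the two control
  functions.\<close>

lemma coarsely_equivalentI_sequences: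
  assumes q: "\<And>x y. q x y \<ge> 0"
    and iff: "\<And>u v :: nat \<Rightarrow> 'a. filterlim (\<lambda>i. p (u i) (v i)) at_top sequentially \<longleftrightarrow>
                filterlim (\<lambda>i. q (u i) (v i)) at_top sequentially"
  shows "coarsely_equivalent p q"
proof -
  have div: "\<exists>s. \<forall>x y. f x y \<ge> s \<longrightarrow> g x y \<ge> K"
    if fg: "\<And>u v. filterlim (\<lambda>i. f (u i) (v i)) at_top sequentially \<Longrightarrow>
              filterlim (\<lambda>i. g (u i) (v i)) at_top sequentially"
    for f g :: "'a \<Rightarrow> 'a \<Rightarrow> real" and K
  proof (rule ccontr)
    assume "\<not> ?thesis"
    then have "\<forall>n::nat. \<exists>x y. f x y \<ge> real n \<and> g x y < K" by (meson not_le)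
    then obtain u v where u: "\<And>n. f (u n) (v n) \<ge> real n" "\<And>n. g (u n) (v n) < K" by metis
    have "filterlim (\<lambda>i. f (u i) (v i)) at_top sequentially"
      using u(1) by (intro filterlim_at_top_mono[OF filterlim_real_sequentially]) auto
    then have "filterlim (\<lambda>i. g (u i) (v i)) at_top sequentially" by (rule fg)
    then have "\<forall>\<^sub>F i in sequentially. K \<le> g (u i) (v i)" by (simp add: filterlim_at_top)
    then show False using u(2) by (auto simp: eventually_sequentially not_le[symmetric])
  qed
  have "\<exists>K. \<forall>xy. p (fst xy) (snd xy) \<le> s \<longrightarrow> q (fst xy) (snd xy) \<le> K" for s
  proof -
    \<comment> \<open>This is used in contraposed form: \<open>p x y \<le> s\<close> excludes
      \<open>q x y \<ge> K\<close>.\<close>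
    obtain K where "\<forall>x y. q x y \<ge> K \<longrightarrow> p x y \<ge> s + 1"
      using div[of q p "s + 1"] iff by blast
    then have "\<forall>x y. p x y \<le> s \<longrightarrow> q x y \<le> K" by (smt (verit))
    then show ?thesis by auto
  qed
  then obtain \<rho>p where \<rho>p: "control_fun \<rho>p" "\<And>xy. q (fst xy) (snd xy) \<le> \<rho>p (p (fst xy) (snd xy))"
    using control_fun_majorant[of "\<lambda>xy. p (fst xy) (snd xy)" "\<lambda>xy. q (fst xy) (snd xy)"] by blast
  have "\<exists>s. \<forall>xy. p (fst xy) (snd xy) \<ge> s \<longrightarrow> q (fst xy) (snd xy) \<ge> K" for K
  proof -
    obtain s where "\<forall>x y. p x y \<ge> s \<longrightarrow> q x y \<ge> K"
      using div[of p q K] iff by blast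
    then show ?thesis by auto
  qed
  then obtain \<rho>m where \<rho>m: "control_fun \<rho>m" "filterlim \<rho>m at_top at_top"
      "\<And>xy. \<rho>m (p (fst xy) (snd xy)) \<le> q (fst xy) (snd xy)"
    using control_fun_divergent_minorant[of "\<lambda>xy. q (fst xy) (snd xy)" "\<lambda>xy. p (fst xy) (snd xy)"] q
    by blast
  have "\<rho>m (p x y) \<le> q x y \<and> q x y \<le> \<rho>p (p x y)" for x y
    using \<rho>p(2)[of "(x, y)"] \<rho>m(3)[of "(x, y)"] by simp
  then show ?thesis
    unfolding coarsely_equivalent_def using \<rho>p(1) \<rho>m(1,2) by blast
qed

text \<open>The divergent lower control function transfers divergence, and symmetry gives the
  converse. Hence one model serves a whole coarse equivalence class.\<close>

lemma product_compatible_coarsely_equivalent: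
  assumes p: "\<And>x y. p x y \<ge> 0" and q: "\<And>x y. q x y \<ge> 0"
    and pq: "coarsely_equivalent p q" and compat: "product_compatible p T e"
  shows "product_compatible q T e"
proof -
  have div: "filterlim (\<lambda>i. g (u i) (v i)) at_top sequentially"
    if fg: "coarsely_equivalent f g" and lim: "filterlim (\<lambda>i. f (u i) (v i)) at_top sequentially"
    for f g :: "'a \<Rightarrow> 'a \<Rightarrow> real" and u v :: "nat \<Rightarrow> 'a"
  proof -
    obtain \<rho> where \<rho>: "filterlim \<rho> at_top at_top" "\<And>x y. \<rho> (f x y) \<le> g x y"
      using fg unfolding coarsely_equivalent_def by blast
    show ?thesis
      using \<rho>(2) by (intro filterlim_at_top_mono[OF filterlim_compose[OF \<rho>(1) lim]]) auto
  qed
  have "filterlim (\<lambda>i. p (u i) (v i)) at_top sequentially \<longleftrightarrow>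
      filterlim (\<lambda>i. q (u i) (v i)) at_top sequentially" for u v :: "nat \<Rightarrow> 'a"
    using div[OF pq] div[OF coarsely_equivalent_sym[OF p q pq]] by blast
  then show ?thesis
    using compat by (simp add: product_compatible_def)
qed

context metric_compactification
begin

lemma product_compatible_imp_coarsely_equivalent:
  assumes p: "product_compatible p mtopology e" and q: "product_compatible q mtopology e"
    and nonneg: "\<And>x y. q x y \<ge> 0"
  shows "coarsely_equivalent p q"
proof -
  have imp: "filterlim (\<lambda>i. g (u i) (v i)) at_top sequentially"
    if f: "product_compatible f mtopology e" and g: "product_compatible g mtopology e"
      and lim: "filterlim (\<lambda>i. f (u i) (v i)) at_top sequentially"
    for f g :: "'a \<Rightarrow> 'a \<Rightarrow> real" and u v :: "nat \<Rightarrow> 'a"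
  proof (rule ccontr)
    assume "\<not> ?thesis"
    from not_filterlim_at_top_subseq[OF this]
    obtain K and r :: "nat \<Rightarrow> nat" where r: "strict_mono r" "\<And>i. g (u (r i)) (v (r i)) < K" by blast
    \<comment> \<open>Along these indices \<open>g\<close> stays below \<open>K\<close> while both
      sequences converge, so the compatibilities of \<open>f\<close> and \<open>g\<close> with the
      same limits collide.\<close>
    obtain s a b where s: "strict_mono s" "conv ((u \<circ> r) \<circ> s) a" "conv ((v \<circ> r) \<circ> s) b"
      by (rule conv_subseq2_ex)
    have "filterlim (\<lambda>i. f (((u \<circ> r) \<circ> s) i) (((v \<circ> r) \<circ> s) i)) at_top sequentially"
      using filterlim_compose[OF lim filterlim_subseq[OF strict_mono_o[OF r(1) s(1)]]] by simp
    then have "a = b \<and> a \<notin> range e"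
      using product_compatibleD[OF f s(2,3)] by blast
    then have "filterlim (\<lambda>i. g (((u \<circ> r) \<circ> s) i) (((v \<circ> r) \<circ> s) i)) at_top sequentially"
      using product_compatibleD[OF g s(2,3)] by blast
    then have "\<forall>\<^sub>F i in sequentially. K \<le> g (((u \<circ> r) \<circ> s) i) (((v \<circ> r) \<circ> s) i)"
      by (simp add: filterlim_at_top)
    then show False
      using r(2) by (auto simp: eventually_sequentially not_le[symmetric])
  qed
  show ?thesis
    using imp[OF p q] imp[OF q p] by (intro coarsely_equivalentI_sequences nonneg) blast
qed

text \<open>Otherwise a subsequence would stay in a closed ball, compact by properness, and
  accumulate at some \<open>y\<close> in \<open>X\<close>, forcing \<open>a = e y\<close>.\<close>

lemma dist_at_top:
  assumes u: "conv u a" and a: "a \<notin> range e"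
  shows "filterlim (\<lambda>i. dist x0 (u i)) at_top sequentially"
proof (rule ccontr)
  assume "\<not> ?thesis"
  from not_filterlim_at_top_subseq[OF this]
  obtain K and r :: "nat \<Rightarrow> nat" where r: "strict_mono r" "\<And>i. dist x0 (u (r i)) < K" by blast
  have "compact (cball x0 K)" by (rule proper) auto
  moreover have "\<forall>i. (u \<circ> r) i \<in> cball x0 K" using r(2) by (auto intro: less_imp_le)
  ultimately obtain y s where s: "strict_mono s" "((u \<circ> r) \<circ> s) \<longlonglongrightarrow> y"
    unfolding compact_def by metis
  have "conv (u \<circ> (r \<circ> s)) (e y)"
    using s(2) unfolding conv_e_iff comp_def by simp
  then have "a = e y"
    using conv_unique[OF conv_subseq[OF u strict_mono_o[OF r(1) s(1)]]] by blast
  then show False using a by blast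
qed

lemma tendsto_D:
  assumes "conv u a" "conv v b"
  shows "(\<lambda>i. D (e (u i)) (e (v i))) \<longlonglongrightarrow> D a b"
proof (rule LIMSEQ_I)
  fix \<epsilon> :: real assume \<epsilon>: "\<epsilon> > 0"
  have ab: "a \<in> M" "b \<in> M" using assms limitin_mspace by blast+
  have "\<forall>\<^sub>F i in sequentially. D (e (u i)) a < \<epsilon> / 2" "\<forall>\<^sub>F i in sequentially. D (e (v i)) b < \<epsilon> / 2"
    using assms half_gt_zero[OF \<epsilon>] unfolding conv_iff by blast+
  then have "\<forall>\<^sub>F i in sequentially. norm (D (e (u i)) (e (v i)) - D a b) < \<epsilon>"
  proof eventually_elim
    case (elim i)
    have "D (e (u i)) (e (v i)) \<le> D (e (u i)) a + (D a b + D b (e (v i)))"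
      using triangle[of "e (u i)" a "e (v i)"] triangle[of a b "e (v i)"] ab by simp
    moreover have "D a b \<le> D a (e (u i)) + (D (e (u i)) (e (v i)) + D (e (v i)) b)"
      using triangle[of a "e (u i)" b] triangle[of "e (u i)" "e (v i)" b] ab by simp
    ultimately show ?case
      using elim commute[of b "e (v i)"] commute[of a "e (u i)"] unfolding real_norm_def by linarith
  qed
  then show "\<exists>N. \<forall>i\<ge>N. norm (D (e (u i)) (e (v i)) - D a b) < \<epsilon>"
    by (simp add: eventually_sequentially)
qed

end

text \<open>The assumption \<open>slow\<close> is a Higson condition on \<open>e\<close> itself: far
  out, \<open>D\<close> cannot see bounded distances. For coarse compactifications it is derived by
  testing with the functions \<open>D a\<close>.\<close>

locale slow_metric_compactification = metric_compactification M D e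
  for M D and e :: "'a::metric_space \<Rightarrow> 'b" +
  fixes x0 :: 'a
  assumes slow: "\<And>R \<epsilon>. \<epsilon> > 0 \<Longrightarrow> \<exists>K. \<forall>x y. K \<le> dist x0 x \<longrightarrow> dist x y \<le> R \<longrightarrow> D (e x) (e y) < \<epsilon>"
begin

text \<open>The weights prevent the value 0 on the diagonal, which gives (CP2), and tend to 0
  towards the boundary, which keeps the limits of \<open>D\<close> visible. The summand 1 keeps the
  denominators positive at \<open>x0\<close>.\<close>

definition gauge :: "'a \<Rightarrow> 'a \<Rightarrow> real" where
  "gauge x y = D (e x) (e y) + 1 / (1 + dist x0 x) + 1 / (1 + dist x0 y)"

definition metric_product :: "'a \<Rightarrow> 'a \<Rightarrow> real" where
  "metric_product x y = inverse (gauge x y)"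

lemma gauge_ge: "1 / (1 + dist x0 x) \<le> gauge x y"
  unfolding gauge_def using nonneg[of "e x" "e y"] by (simp add: add_increasing add_increasing2)

lemma gauge_pos: "gauge x y > 0"
  using gauge_ge[of x y] by (smt (verit) zero_le_dist divide_pos_pos)

lemma gauge_commute: "gauge x y = gauge y x"
  by (simp add: gauge_def commute)

lemma gauge_triangle: "gauge x z \<le> gauge x y + gauge y z"
proof -
  \<comment> \<open>The weight of \<open>y\<close> occurs only on the right-hand side and may be
    dropped.\<close>
  have "0 \<le> 1 / (1 + dist x0 y)" by simp
  then show ?thesis
    using triangle[OF e_in e_in e_in, of x z y] unfolding gauge_def by linarith
qed

lemma metric_product_ge:
  assumes "s > 0" "gauge x y \<le> 1 / s"
  shows "s \<le> metric_product x y"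
  using le_imp_inverse_le[OF assms(2) gauge_pos] by (simp add: metric_product_def)

lemma product_compatible_metric_product: "product_compatible metric_product mtopology e"
  unfolding product_compatible_def
proof (intro allI impI)
  fix u v a b assume u: "conv u a" and v: "conv v b"
  have ab: "a \<in> M" "b \<in> M" using u v limitin_mspace by blast+
  have "filterlim (\<lambda>i. metric_product (u i) (v i)) at_top sequentially \<longleftrightarrow>
      (\<lambda>i. gauge (u i) (v i)) \<longlonglongrightarrow> 0"
    unfolding metric_product_def by (intro filterlim_inverse_at_top_iff) (simp add: gauge_pos)
  also have "\<dots> \<longleftrightarrow> a = b \<and> a \<notin> range e"
  proof
    assume lim: "(\<lambda>i. gauge (u i) (v i)) \<longlonglongrightarrow> 0"
    have "(\<lambda>i. D (e (u i)) (e (v i))) \<longlonglongrightarrow> 0"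
      by (rule tendsto_sandwich[OF _ _ tendsto_const lim]) (auto simp: gauge_def)
    then have "D a b = 0" using tendsto_D[OF u v] LIMSEQ_unique by blast
    then have "a = b" using ab by simp
    \<comment> \<open>If \<open>u\<close> converged in \<open>X\<close>, its weights, which are
      dominated by the gauge, would tend to a positive number.\<close>
    moreover have False if x: "a = e x" for x
    proof -
      have pos: "1 + dist x0 x > 0" using zero_le_dist[of x0 x] by linarith
      have "u \<longlonglongrightarrow> x" using u x conv_e_iff by simp
      then have "(\<lambda>i. 1 / (1 + dist x0 (u i))) \<longlonglongrightarrow> 1 / (1 + dist x0 x)"
        using pos by (intro tendsto_intros) auto
      moreover have "(\<lambda>i. 1 / (1 + dist x0 (u i))) \<longlonglongrightarrow> 0"
        by (rule tendsto_sandwich[OF _ _ tendsto_const lim]) (auto simp: gauge_ge)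
      ultimately have "1 / (1 + dist x0 x) = 0" using LIMSEQ_unique by blast
      then show False using pos by simp
    qed
    ultimately show "a = b \<and> a \<notin> range e" by blast
  next
    assume a: "a = b \<and> a \<notin> range e"
    have lim: "(\<lambda>i. 1 / (1 + dist x0 (w i))) \<longlonglongrightarrow> 0" if "conv w a" for w
    proof -
      have "filterlim (\<lambda>i. 1 + dist x0 (w i)) at_top sequentially"
        using dist_at_top[OF that] a by (intro filterlim_tendsto_add_at_top[OF tendsto_const]) auto
      from tendsto_inverse_0_at_top[OF this] show ?thesis by (simp add: inverse_eq_divide)
    qed
    show "(\<lambda>i. gauge (u i) (v i)) \<longlonglongrightarrow> 0"
      using tendsto_add[OF tendsto_add[OF tendsto_D[OF u v] lim[OF u]] lim[of v]] a v ab
      by (simp add: gauge_def)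
  qed
  finally show "filterlim (\<lambda>i. metric_product (u i) (v i)) at_top sequentially \<longleftrightarrow> a = b \<and> a \<notin> range e" .
qed

lemma CP1_metric_product: "CP1 metric_product"
  unfolding CP1_def
proof (intro exI[of _ "\<lambda>t. 2 * t"] conjI allI)
  show "control_fun ((*) 2)" by (auto simp: control_fun_def intro: mono_onI)
  show "min (metric_product x y) (metric_product y z) \<le> 2 * metric_product x z" for x y z
  proof -
    \<comment> \<open>The smaller reciprocal belongs to the larger gauge \<open>m\<close>, and
      \<open>gauge x z\<close> is at most \<open>2 * m\<close>; hence the factor 2 in (CP1).\<close>
    define m where "m = max (gauge x y) (gauge y z)"
    have m: "m > 0" "gauge x z \<le> 2 * m"
      using gauge_pos[of x y] gauge_triangle[of x z y] by (auto simp: m_def)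
    have "min (metric_product x y) (metric_product y z) \<le> inverse m"
      by (auto simp: metric_product_def m_def max_def)
    also have "\<dots> \<le> 2 * inverse (gauge x z)"
      using le_imp_inverse_le[OF m(2) gauge_pos] by simp
    finally show ?thesis by (simp add: metric_product_def)
  qed
qed

lemma CP2_metric_product: "CP2 x0 metric_product"
  unfolding CP2_def
proof (intro exI[of _ "\<lambda>t. 1 + t"] conjI allI)
  show "control_fun ((+) 1)" by (auto simp: control_fun_def intro: mono_onI)
  show "metric_product x y \<le> 1 + dist x0 x" for x y
    using le_imp_inverse_le[OF gauge_ge[of x y]] by (simp add: metric_product_def add_pos_nonneg)
qed

text \<open>If \<open>x\<close> is far out and \<open>y\<close> within distance \<open>t\<close>,
  each of the three summands of the gauge is at most \<open>1 / (3 * s')\<close>, so the product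
  reaches \<open>s'\<close>. This is (CP3) before packaging into a monotone function.\<close>

lemma metric_product_bound:
  "\<exists>K. \<forall>x y. metric_product x y \<le> s \<longrightarrow> dist x y \<le> t \<longrightarrow> dist x0 x \<le> K"
proof -
  \<comment> \<open>Positive even for negative \<open>s\<close>, and strictly above \<open>s\<close>
    for the contradiction.\<close>
  define s' where "s' = max s 0 + 1"
  have s': "s' > 0" "s < s'" by (auto simp: s'_def)
  obtain K where K: "\<forall>x y. K \<le> dist x0 x \<longrightarrow> dist x y \<le> t \<longrightarrow> D (e x) (e y) < 1 / (3 * s')"
    using slow[of "1 / (3 * s')" t] s' by auto
  have "dist x0 x \<le> max K (3 * s' + t)" if q: "metric_product x y \<le> s" "dist x y \<le> t" for x y
  proof (rule ccontr)
    assume "\<not> ?thesis"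
    then have x: "dist x0 x \<ge> K" "dist x0 x \<ge> 3 * s' + t" by auto
    have "dist x0 y \<ge> 3 * s'"
      using x(2) q(2) dist_triangle[of x0 x y] by (simp add: dist_commute)
    moreover have "dist x0 x \<ge> 3 * s'"
      using x(2) q(2) zero_le_dist[of x y] by linarith
    ultimately have "1 / (1 + dist x0 x) \<le> 1 / (3 * s')" "1 / (1 + dist x0 y) \<le> 1 / (3 * s')"
      using s' by (auto intro!: divide_left_mono mult_pos_pos)
    moreover have "D (e x) (e y) < 1 / (3 * s')" using K x(1) q(2) by blast
    ultimately have "gauge x y \<le> 3 * (1 / (3 * s'))"
      unfolding gauge_def by linarith
    then have "s' \<le> metric_product x y"
      using s' by (intro metric_product_ge) auto
    then show False using q(1) s'(2) by simp
  qed
  then show ?thesis by blast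
qed

lemma CP3_metric_product: "CP3 x0 metric_product"
proof -
  define A where "A s t = insert 0 {dist x0 x | x y. metric_product x y \<le> s \<and> dist x y \<le> t}" for s t
  have bdd: "bdd_above (A s t)" for s t
  proof -
    obtain K where "\<forall>x y. metric_product x y \<le> s \<longrightarrow> dist x y \<le> t \<longrightarrow> dist x0 x \<le> K"
      using metric_product_bound by blast
    then show ?thesis
      unfolding A_def by (intro bdd_aboveI[of _ "max 0 K"]) (auto simp: le_max_iff_disj)
  qed
  show ?thesis
    unfolding CP3_def
  proof (intro exI[of _ "\<lambda>s t. Sup (A s t)"] conjI allI impI)
    show "0 \<le> Sup (A s t)" for s t by (rule cSup_upper[OF _ bdd]) (simp add: A_def)
    show "Sup (A s1 t1) \<le> Sup (A s2 t2)" if "s1 \<le> s2" "t1 \<le> t2" for s1 t1 s2 t2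
      using that by (intro cSup_subset_mono bdd) (auto simp: A_def intro: order_trans)
    show "dist x0 x \<le> Sup (A (metric_product x y) (dist x y))" for x y
      by (rule cSup_upper[OF _ bdd]) (auto simp: A_def)
  qed
qed

text \<open>Finitely many small \<open>D\<close>-balls with centres far from \<open>x0\<close> cover
  the images of all far points. A far point and the centre of its ball make all three gauge summands
  small, and a large \<open>r\<close> takes in every centre.\<close>

lemma CP4_metric_product: "CP4 x0 metric_product"
proof -
  define P where "P R r \<longleftrightarrow> (\<forall>x. dist x0 x > r \<longrightarrow> (\<exists>y. dist x0 y \<le> r \<and> metric_product x y \<ge> R))" for R r
  have ex: "\<exists>r\<ge>0. P R r" if "R \<ge> 0" for R
  proof -
    \<comment> \<open>Since \<open>R\<close> may be 0, a positive bound is chosen for use as a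
      denominator.\<close>
    define s where "s = R + 1"
    have s: "s > 0" using that by (simp add: s_def)
    define A where "A = e ` {x. dist x0 x \<ge> 3 * s}"
    have "A \<subseteq> M" by (auto simp: A_def)
    then have "mtotally_bounded A"
      using compact_space mtotally_bounded_subset unfolding compact_space_eq_mcomplete_mtotally_bounded
      by blast
    then obtain F where F: "finite F" "F \<subseteq> A" "A \<subseteq> (\<Union>a\<in>F. mball a (1 / (3 * s)))"
      unfolding mtotally_bounded_def using s by (metis divide_pos_pos mult_pos_pos zero_less_numeral zero_less_one)
    obtain G where G: "finite G" "G \<subseteq> {x. dist x0 x \<ge> 3 * s}" "F = e ` G"
      using F(1,2) unfolding A_def by (rule finite_subset_image[THEN exE]) blast
    \<comment> \<open>The sum dominates the distance to each centre and, unlike a maximum, causes no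
      case distinction for empty \<open>G\<close>.\<close>
    define r where "r = 3 * s + (\<Sum>y\<in>G. dist x0 y)"
    have r: "r \<ge> 3 * s" by (auto simp: r_def intro!: sum_nonneg)
    have "\<exists>y. dist x0 y \<le> r \<and> metric_product x y \<ge> R" if x: "dist x0 x > r" for x
    proof -
      have "e x \<in> A" using x r by (auto simp: A_def)
      then obtain y where y: "y \<in> G" "D (e y) (e x) < 1 / (3 * s)"
        using F(3) G(3) by auto
      have "dist x0 y \<le> (\<Sum>y\<in>G. dist x0 y)"
        using y(1) G(1) by (intro member_le_sum) auto
      then have "dist x0 y \<le> r" using s by (simp add: r_def)
      moreover have "dist x0 x \<ge> 3 * s" "dist x0 y \<ge> 3 * s" using x r y(1) G(2) by auto
      then have "1 / (1 + dist x0 x) \<le> 1 / (3 * s)" "1 / (1 + dist x0 y) \<le> 1 / (3 * s)"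
        using s by (auto intro!: divide_left_mono mult_pos_pos)
      then have "gauge x y \<le> 3 * (1 / (3 * s))"
        using y(2) commute[of "e x" "e y"] unfolding gauge_def by linarith
      then have "s \<le> metric_product x y"
        using s by (intro metric_product_ge) auto
      ultimately show ?thesis by (auto simp: s_def intro!: exI[of _ y])
    qed
    then show ?thesis using r s by (intro exI[of _ r]) (auto simp: P_def)
  qed
  have mono: "P R' r'" if "P R r" "0 \<le> R'" "R' \<le> R" "r \<le> r'" for R R' r r'
    using that unfolding P_def by (meson le_less_trans order_trans)
  have "\<exists>\<rho>. control_fun \<rho> \<and> (\<forall>R\<ge>0. P R (\<rho> R))"
    using ex mono by (rule control_fun_choice)
  then show ?thesis unfolding CP4_def P_def by blast
qed

lemma controlled_product_metric_product: "controlled_product x0 metric_product"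
  unfolding controlled_product_def
proof (intro conjI allI CP1_metric_product CP2_metric_product CP3_metric_product CP4_metric_product)
  show "0 \<le> metric_product x y" for x y
    using gauge_pos[of x y] by (simp add: metric_product_def)
  show "metric_product x y = metric_product y x" for x y
    by (simp add: metric_product_def gauge_commute)
qed

end

section \<open>Metrization of a controlled product\<close>

definition path_length :: "('a \<Rightarrow> 'a \<Rightarrow> real) \<Rightarrow> (nat \<Rightarrow> 'a) \<Rightarrow> nat \<Rightarrow> real" where
  "path_length E f n = (\<Sum>i<n. E (f i) (f (Suc i)))"

text \<open>The infimum over finite chains is the largest pseudometric below \<open>E\<close> when
  \<open>E\<close> satisfies \<open>quasi_metric\<close>.\<close>

definition path_metric :: "('a \<Rightarrow> 'a \<Rightarrow> real) \<Rightarrow> 'a \<Rightarrow> 'a \<Rightarrow> real" where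
  "path_metric E x y = Inf {path_length E f n | f n. f 0 = x \<and> f n = y}"

text \<open>The condition \<open>quad\<close> is the relaxed triangle inequality of Frink's lemma;
  its constant 2 bounds \<open>E\<close> by twice the length of any chain.\<close>

locale quasi_metric =
  fixes E :: "'a \<Rightarrow> 'a \<Rightarrow> real"
  assumes E_nonneg: "E x y \<ge> 0"
    and E_refl: "E x x = 0"
    and E_sym: "E x y = E y x"
    and quad: "E a d \<le> 2 * max (E a b) (max (E b c) (E c d))"
begin

text \<open>Frink's chain argument: cut the path at the last point before which at most half of the total
  length is used; both remaining pieces and the link between them are controlled by induction.\<close>

lemma quasi_metric_le_sum:
  "m \<le> n \<Longrightarrow> E (f m) (f n) \<le> 2 * (\<Sum>i=m..<n. E (f i) (f (Suc i)))"
proof (induction "n - m" arbitrary: m n rule: less_induct)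
  case less
  define S where "S a b = (\<Sum>i=a..<b. E (f i) (f (Suc i)))" for a b
  have S_nn: "S a b \<ge> 0" for a b
    unfolding S_def by (intro sum_nonneg E_nonneg)
  show ?case
  proof (cases "m = n")
    case True
    then show ?thesis by (simp add: E_refl)
  next
    case False
    then have "m < n" using less.prems by simp
    define K where "K = {k. m \<le> k \<and> k < n \<and> S m k \<le> S m n / 2}"
    have "finite K" "m \<in> K"
      using S_nn[of m n] \<open>m < n\<close> by (auto simp: K_def S_def)
    define k where "k = Max K"
    have "k \<in> K" using \<open>finite K\<close> \<open>m \<in> K\<close> unfolding k_def by (intro Max_in) auto
    then have k: "m \<le> k" "k < n" "S m k \<le> S m n / 2" by (auto simp: K_def)
    have split: "S m n = S m k + E (f k) (f (Suc k)) + S (Suc k) n"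
    proof -
      have "S m n = S m k + S k n"
        using k by (simp add: S_def sum.atLeastLessThan_concat)
      also have "S k n = E (f k) (f (Suc k)) + S (Suc k) n"
        using k by (simp add: S_def sum.atLeast_Suc_lessThan)
      finally show ?thesis by simp
    qed
    have "S (Suc k) n \<le> S m n / 2"
    proof (cases "Suc k = n")
      case True
      then show ?thesis using S_nn[of m n] by (simp add: S_def)
    next
      case False
      then have "Suc k \<notin> K" using \<open>finite K\<close> by (metis Max_ge Suc_n_not_le_n k_def)
      then have "S m (Suc k) > S m n / 2" using k False by (auto simp: K_def)
      moreover have "S m (Suc k) = S m k + E (f k) (f (Suc k))"
        using k by (simp add: S_def)
      ultimately show ?thesis using split by linarith
    qed
    moreover have "E (f m) (f k) \<le> 2 * S m k"
      using less.hyps[of k m] k unfolding S_def by simp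
    moreover have "E (f (Suc k)) (f n) \<le> 2 * S (Suc k) n"
      using less.hyps[of n "Suc k"] k unfolding S_def by simp
    \<comment> \<open>A single link costs at most the total length, so all three arguments of the
      maximum in \<open>quad\<close> are at most \<open>S m n\<close>.\<close>
    moreover have "E (f k) (f (Suc k)) \<le> S m n"
      using split S_nn[of m k] S_nn[of "Suc k" n] by linarith
    ultimately have "max (E (f m) (f k)) (max (E (f k) (f (Suc k))) (E (f (Suc k)) (f n))) \<le> S m n"
      using k(3) by simp
    then show ?thesis
      using quad[of "f m" "f n" "f k" "f (Suc k)"] unfolding S_def by linarith
  qed
qed

lemma path_length_ge: "E (f 0) (f n) \<le> 2 * path_length E f n"
  using quasi_metric_le_sum[of 0 n f] by (simp add: path_length_def atLeast0LessThan)

lemma path_length_nonneg: "path_length E f n \<ge> 0"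
  unfolding path_length_def by (intro sum_nonneg E_nonneg)

lemma path_metric_le_path_length: "path_metric E (f 0) (f n) \<le> path_length E f n"
  unfolding path_metric_def
proof (rule cInf_lower)
  show "bdd_below {path_length E g m | g m. g 0 = f 0 \<and> g m = f n}"
    using path_length_nonneg by (intro bdd_belowI[of _ 0]) blast
qed blast

lemma path_metric_greatest:
  assumes "\<And>f n. f 0 = x \<Longrightarrow> f n = y \<Longrightarrow> c \<le> path_length E f n"
  shows "c \<le> path_metric E x y"
  unfolding path_metric_def
proof (rule cInf_greatest)
  have "path_length E (\<lambda>i. if i = 0 then x else y) 1 \<in> {path_length E f n | f n. f 0 = x \<and> f n = y}"
    by (intro CollectI exI[of _ "\<lambda>i. if i = 0 then x else y"] exI[of _ "1::nat"]) auto
  then show "{path_length E f n | f n. f 0 = x \<and> f n = y} \<noteq> {}" by blast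
qed (use assms in blast)

lemma path_metric_nonneg: "path_metric E x y \<ge> 0"
  by (intro path_metric_greatest path_length_nonneg)

lemma path_metric_le: "path_metric E x y \<le> E x y"
  using path_metric_le_path_length[of "\<lambda>i. if i = 0 then x else y" 1] by (simp add: path_length_def)

lemma le_path_metric: "E x y \<le> 2 * path_metric E x y"
proof -
  have "E x y / 2 \<le> path_metric E x y"
  proof (rule path_metric_greatest)
    fix f :: "nat \<Rightarrow> 'a" and n assume "f 0 = x" "f n = y"
    then show "E x y / 2 \<le> path_length E f n"
      using path_length_ge[of f n] by simp
  qed
  then show ?thesis by simp
qed

lemma path_metric_commute: "path_metric E x y = path_metric E y x"
proof -
  have "path_metric E y x \<le> path_metric E x y" for x y
  proof (rule path_metric_greatest)
    fix f :: "nat \<Rightarrow> 'a" and n assume f: "f 0 = x" "f n = y"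
    have "path_length E (\<lambda>i. f (n - i)) n = (\<Sum>i<n. E (f (n - Suc i)) (f (Suc (n - Suc i))))"
      unfolding path_length_def by (intro sum.cong) (auto simp: Suc_diff_Suc E_sym)
    also have "\<dots> = path_length E f n"
      unfolding path_length_def by (rule sum.nat_diff_reindex)
    finally show "path_metric E y x \<le> path_length E f n"
      using path_metric_le_path_length[of "\<lambda>i. f (n - i)" n] f by simp
  qed
  then show ?thesis by (intro antisym)
qed

lemma path_metric_triangle: "path_metric E x z \<le> path_metric E x y + path_metric E y z"
proof -
  \<comment> \<open>The two infima are taken one after the other, the first over chains from
    \<open>y\<close> to \<open>z\<close> with the other chain fixed.\<close>
  have "path_metric E x z - path_length E f n \<le> path_metric E y z"
    if f: "f 0 = x" "f n = y" for f n
  proof (rule path_metric_greatest)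
    fix g :: "nat \<Rightarrow> 'a" and m assume g: "g 0 = y" "g m = z"
    \<comment> \<open>At index \<open>n\<close> the concatenation takes
      \<open>g 0 = y = f n\<close>, so the last link of \<open>f\<close> is preserved.\<close>
    define h where "h i = (if i < n then f i else g (i - n))" for i
    have "path_length E h (n + m) = path_length E h n + (\<Sum>i<m. E (h (n + i)) (h (Suc (n + i))))"
      unfolding path_length_def by (induction m) auto
    also have "path_length E h n = path_length E f n"
      unfolding path_length_def
    proof (intro sum.cong refl)
      fix i assume "i \<in> {..<n}"
      then have "h i = f i" "h (Suc i) = f (Suc i)"
        using f(2) g(1) by (auto simp: h_def less_Suc_eq_le not_less intro: le_antisym) (metis le_antisym Suc_leI)
      then show "E (h i) (h (Suc i)) = E (f i) (f (Suc i))" by simp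
    qed
    also have "(\<Sum>i<m. E (h (n + i)) (h (Suc (n + i)))) = path_length E g m"
      by (simp add: path_length_def h_def)
    finally have "path_length E h (n + m) = path_length E f n + path_length E g m" .
    moreover have "h 0 = x" "h (n + m) = z"
      using f g by (auto simp: h_def)
    ultimately show "path_metric E x z - path_length E f n \<le> path_length E g m"
      using path_metric_le_path_length[of h "n + m"] by simp
  qed
  then have "path_metric E x z - path_metric E y z \<le> path_metric E x y"
    by (intro path_metric_greatest) (simp add: algebra_simps)
  then show ?thesis by simp
qed

end

text \<open>Setting of the metrization lemma for uniformities. Triple rather than double composition
  is what \<open>quad\<close> asks for.\<close>

locale entourage_sequence =
  fixes U :: "nat \<Rightarrow> 'a \<Rightarrow> 'a \<Rightarrow> bool"
  assumes U_0: "U 0 x y"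
    and U_refl: "U k x x"
    and U_sym: "U k x y \<Longrightarrow> U k y x"
    and comp3: "U (Suc k) a b \<Longrightarrow> U (Suc k) b c \<Longrightarrow> U (Suc k) c d \<Longrightarrow> U k a d"
begin

text \<open>Taking the first failing index, not the last successful one, makes the strict balls of
  radius \<open>(1/2) ^ k\<close> exactly the entourages.\<close>

definition gauge :: "'a \<Rightarrow> 'a \<Rightarrow> real" where
  "gauge x y = (if \<forall>k. U k x y then 0 else (1/2) ^ (LEAST k. \<not> U k x y))"

lemma antimono: "U m x y \<Longrightarrow> k \<le> m \<Longrightarrow> U k x y"
proof (induction m)
  case (Suc m)
  have "U m x y" using comp3[OF Suc.prems(1) U_refl U_refl] .
  then show ?case using Suc by (cases "k = Suc m") auto
qed simp

lemma gauge_less_iff: "gauge x y < (1/2) ^ k \<longleftrightarrow> U k x y"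
proof (cases "\<forall>k. U k x y")
  case True
  then show ?thesis by (simp add: gauge_def)
next
  case False
  define m where "m = (LEAST k. \<not> U k x y)"
  have "\<not> U m x y" using False unfolding m_def by (metis LeastI)
  then have "U k x y \<longleftrightarrow> k < m"
    using antimono not_less_Least[of k "\<lambda>k. \<not> U k x y"] unfolding m_def by (meson not_le)
  moreover have "gauge x y = (1/2) ^ m" using False by (simp add: gauge_def m_def)
  ultimately show ?thesis by (simp add: power_strict_decreasing_iff)
qed

sublocale quasi_metric gauge
proof
  show "gauge x y \<ge> 0" for x y by (simp add: gauge_def)
  show "gauge x x = 0" for x by (simp add: gauge_def U_refl)
  have "U k x y \<longleftrightarrow> U k y x" for k x y using U_sym by blast
  then show "gauge x y = gauge y x" for x y by (simp add: gauge_def)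
  show "gauge a d \<le> 2 * max (gauge a b) (max (gauge b c) (gauge c d))" for a b c d
  proof (rule ccontr)
    assume "\<not> ?thesis"
    then have less: "2 * gauge a b < gauge a d" "2 * gauge b c < gauge a d" "2 * gauge c d < gauge a d"
      by auto
    have "gauge a b \<ge> 0" by (simp add: gauge_def)
    with less(1) have "gauge a d \<noteq> 0" by simp
    \<comment> \<open>A nonzero gauge is a power of 1/2, so lying below half of it means belonging
      to the next entourage; \<open>comp3\<close> then gives \<open>U j a d\<close>, against the
      value of the gauge.\<close>
    then obtain j where j: "gauge a d = (1/2) ^ j"
      by (auto simp: gauge_def split: if_splits)
    have "gauge a b < (1/2) ^ Suc j" "gauge b c < (1/2) ^ Suc j" "gauge c d < (1/2) ^ Suc j"
      using less j by auto
    then have "U j a d" unfolding gauge_less_iff by (rule comp3)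
    then show False using j gauge_less_iff[of a d j] by simp
  qed
qed

text \<open>The factor 2 between the gauge and its path metric costs one index here, and none in the
  converse below.\<close>

lemma path_metric_imp_U: "path_metric gauge x y < (1/2) ^ Suc k \<Longrightarrow> U k x y"
  using le_path_metric[of x y] gauge_less_iff[of x y k] by simp

lemma U_imp_path_metric: "U k x y \<Longrightarrow> path_metric gauge x y < (1/2) ^ k"
  using path_metric_le[of x y] gauge_less_iff[of x y k] by simp

end

section \<open>The uniformity and the completion of a controlled product\<close>

locale controlled =
  fixes x0 :: "'a::metric_space" and p :: "'a \<Rightarrow> 'a \<Rightarrow> real" and \<rho>1 \<rho>2 \<rho>3
  assumes proper: "\<And>S :: 'a set. closed S \<Longrightarrow> bounded S \<Longrightarrow> compact S"
    and p_nonneg: "p x y \<ge> 0"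
    and p_sym: "p x y = p y x"
    and \<rho>1: "control_fun \<rho>1" "\<And>x y z. min (p x y) (p y z) \<le> \<rho>1 (p x z)"
    and \<rho>2: "control_fun \<rho>2" "\<And>x y. p x y \<le> \<rho>2 (dist x0 x)"
    and \<rho>3_nonneg: "\<And>s t. s \<ge> 0 \<Longrightarrow> t \<ge> 0 \<Longrightarrow> \<rho>3 s t \<ge> 0"
    and \<rho>3_mono: "\<And>s1 t1 s2 t2. 0 \<le> s1 \<Longrightarrow> 0 \<le> t1 \<Longrightarrow> s1 \<le> s2 \<Longrightarrow> t1 \<le> t2 \<Longrightarrow> \<rho>3 s1 t1 \<le> \<rho>3 s2 t2"
    and \<rho>3: "\<And>x y. dist x0 x \<le> \<rho>3 (p x y) (dist x y)"
    and p_dense: "\<And>R. R \<ge> 0 \<Longrightarrow> \<exists>r. \<forall>x. dist x0 x > r \<longrightarrow> (\<exists>y. dist x0 y \<le> r \<and> p x y \<ge> R)"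
begin

text \<open>(CP3) contraposed: far from \<open>x0\<close>, a bounded distance forces a large
  product.\<close>

lemma product_gt_if_near_far:
  assumes "s \<ge> 0" "dist x y \<le> t" "dist x0 x > \<rho>3 s t"
  shows "p x y > s"
proof (rule ccontr)
  assume "\<not> ?thesis"
  then have "\<rho>3 (p x y) (dist x y) \<le> \<rho>3 s t"
    using assms p_nonneg by (intro \<rho>3_mono) auto
  then show False using assms(3) \<rho>3[of x y] by simp
qed

lemma product_gt_trans:
  assumes "n \<ge> 0" "p x y > \<rho>1 n" "p y z > \<rho>1 n"
  shows "p x z > n"
proof (rule ccontr)
  assume "\<not> ?thesis"
  then have "\<rho>1 (p x z) \<le> \<rho>1 n"
    using p_nonneg by (intro control_fun_mono[OF \<rho>1(1)]) auto
  then show False using assms \<rho>1(2)[of x y z] by simp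
qed

text \<open>The entry \<open>\<rho>1 n\<close> serves compositions of two product conditions. A
  product above \<open>\<rho>2 (\<rho>3 (\<rho>1 n) 1)\<close> places both points farther than
  \<open>\<rho>3 (\<rho>1 n) 1\<close> from \<open>x0\<close>, where a jump of length at most 1 has
  product above \<open>\<rho>1 n\<close>. The entry \<open>n + 1\<close> makes the thresholds
  diverge.\<close>

definition step :: "real \<Rightarrow> real" where
  "step n = max (n + 1) (max (\<rho>1 n) (\<rho>2 (\<rho>3 (\<rho>1 n) 1)))"

definition near :: "real \<Rightarrow> real \<Rightarrow> 'a \<Rightarrow> 'a \<Rightarrow> bool" where
  "near n \<delta> x y \<longleftrightarrow> p x y > n \<or> dist x y < \<delta>"

lemma near_sym: "near n \<delta> x y \<longleftrightarrow> near n \<delta> y x"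
  by (simp add: near_def p_sym[of x y] dist_commute)

lemma near_mono: "near m \<delta> x y \<Longrightarrow> n \<le> m \<Longrightarrow> \<delta> \<le> \<epsilon> \<Longrightarrow> near n \<epsilon> x y"
  by (auto simp: near_def)

lemma step_ge: "step n \<ge> n + 1" "step n \<ge> \<rho>1 n" "step n \<ge> \<rho>2 (\<rho>3 (\<rho>1 n) 1)"
  by (auto simp: step_def)

lemma near_trans_mixed:
  assumes n: "n \<ge> 0" and "p x y > step n" "dist y z \<le> 1"
  shows "p x z > n"
proof -
  have \<rho>1n: "\<rho>1 n \<ge> 0" using control_fun_nonneg[OF \<rho>1(1)] n by simp
  have "dist x0 y > \<rho>3 (\<rho>1 n) 1"
  proof (rule ccontr)
    assume "\<not> ?thesis"
    then have "\<rho>2 (dist x0 y) \<le> \<rho>2 (\<rho>3 (\<rho>1 n) 1)"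
      by (intro control_fun_mono[OF \<rho>2(1)]) auto
    then show False
      using \<rho>2(2)[of y x] p_sym[of x y] assms(2) step_ge(3)[of n] by simp
  qed
  then have "p y z > \<rho>1 n"
    using product_gt_if_near_far[OF \<rho>1n assms(3)] by simp
  moreover have "p x y > \<rho>1 n" using assms(2) step_ge(2)[of n] by simp
  ultimately show ?thesis by (intro product_gt_trans[OF n])
qed

text \<open>The bound on \<open>\<delta>\<close> brings metric links into the range of the mixed
  case; two metric links add up by the triangle inequality, hence the halving.\<close>

lemma near_trans:
  assumes n: "n \<ge> 0" and \<delta>: "\<delta> \<le> 1" and xy: "near (step n) (\<delta> / 2) x y" and yz: "near (step n) (\<delta> / 2) y z"
  shows "near n \<delta> x z"
proof -
  consider "p x y > step n" "p y z > step n" | "p x y > step n" "dist y z < \<delta> / 2"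
    | "dist x y < \<delta> / 2" "p y z > step n" | "dist x y < \<delta> / 2" "dist y z < \<delta> / 2"
    using xy yz by (auto simp: near_def)
  then show ?thesis
  proof cases
    case 1
    then show ?thesis
      using product_gt_trans[OF n, of x y z] step_ge(2)[of n] by (simp add: near_def)
  next
    case 2
    then have "dist y z \<le> 1" using \<delta> zero_le_dist[of y z] by linarith
    then show ?thesis using near_trans_mixed[OF n 2(1)] by (simp add: near_def)
  next
    case 3
    then have "dist y x \<le> 1" using \<delta> zero_le_dist[of y x] by (simp add: dist_commute)
    moreover have "p z y > step n" using 3 by (simp add: p_sym)
    ultimately show ?thesis using near_trans_mixed[OF n, of z y x] p_sym[of x z] by (simp add: near_def)
  next
    case 4
    then show ?thesis using dist_triangle[of x z y] by (simp add: near_def)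
  qed
qed

text \<open>Two steps per index, because a triple composition is two successive compositions; the
  factor 1/4 in \<open>entourage\<close> halves the metric part twice for the same reason.\<close>

definition threshold :: "nat \<Rightarrow> real" where
  "threshold k = ((\<lambda>n. step (step n)) ^^ k) 0"

text \<open>Index 0 is spent on the total relation \<open>U_0\<close>. This shift by one explains
  the exponents \<open>Suc k\<close> in the estimates for \<open>\<Delta>\<close>.\<close>

definition entourage :: "nat \<Rightarrow> 'a \<Rightarrow> 'a \<Rightarrow> bool" where
  "entourage k x y \<longleftrightarrow> (case k of 0 \<Rightarrow> True | Suc j \<Rightarrow> near (threshold j) ((1/4) ^ j) x y)"

lemma threshold_ge: "real k \<le> threshold k"
proof (induction k)
  case (Suc k)
  have "threshold (Suc k) = step (step (threshold k))" by (simp add: threshold_def)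
  then show ?case
    using Suc step_ge(1)[of "threshold k"] step_ge(1)[of "step (threshold k)"] by simp
qed (simp add: threshold_def)

lemma threshold_nonneg: "threshold k \<ge> 0"
  using threshold_ge[of k] by (meson of_nat_0_le_iff order_trans)

sublocale entourage_sequence entourage
proof
  show "entourage 0 x y" for x y by (simp add: entourage_def)
  show "entourage k x x" for k x by (simp add: entourage_def near_def split: nat.split)
  show "entourage k y x" if "entourage k x y" for k x y
    using that near_sym by (simp add: entourage_def split: nat.splits)
  show "entourage k a d" if "entourage (Suc k) a b" "entourage (Suc k) b c" "entourage (Suc k) c d" for k a b c d
  proof (cases k)
    case 0
    then show ?thesis by (simp add: entourage_def)
  next
    case (Suc j)
    define n \<delta> where "n = threshold j" and "\<delta> = (1/4::real) ^ j"
    have n: "n \<ge> 0" and \<delta>: "0 < \<delta>" "\<delta> \<le> 1"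
      by (auto simp: n_def \<delta>_def threshold_nonneg power_le_one)
    have step: "near (step (step n)) (\<delta> / 2 / 2) a b" "near (step (step n)) (\<delta> / 2 / 2) b c"
      "near (step (step n)) (\<delta> / 2 / 2) c d"
      using that by (simp_all add: Suc entourage_def threshold_def n_def \<delta>_def)
    have "step n \<ge> 0" using step_ge(1)[of n] n by linarith
    then have "near (step n) (\<delta> / 2) a c"
      using near_trans[OF _ _ step(1,2)] \<delta> by simp
    \<comment> \<open>Only one composition remains for the third link, so it is weakened to the
      level reached by \<open>a\<close> and \<open>c\<close>.\<close>
    moreover have "near (step n) (\<delta> / 2) c d"
      using step(3) by (rule near_mono) (use step_ge(1)[of "step n"] \<delta> in auto)
    ultimately have "near n \<delta> a d" by (rule near_trans[OF n \<delta>(2)])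
    then show ?thesis by (simp add: Suc entourage_def n_def \<delta>_def)
  qed
qed

abbreviation \<Delta> :: "'a \<Rightarrow> 'a \<Rightarrow> real" where
  "\<Delta> \<equiv> path_metric gauge"

lemma \<Delta>_less_if_product: "p x y > threshold k \<Longrightarrow> \<Delta> x y < (1/2) ^ Suc k"
  by (intro U_imp_path_metric) (simp add: entourage_def near_def)

lemma \<Delta>_less_if_dist: "dist x y < (1/4) ^ k \<Longrightarrow> \<Delta> x y < (1/2) ^ Suc k"
  by (intro U_imp_path_metric) (simp add: entourage_def near_def)

lemma \<Delta>_lessD: "\<Delta> x y < (1/2) ^ Suc (Suc k) \<Longrightarrow> p x y > threshold k \<or> dist x y < (1/4) ^ k"
  using path_metric_imp_U[of x y "Suc k"] by (simp add: entourage_def near_def)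

lemma half_power_ex: "\<epsilon> > 0 \<Longrightarrow> \<exists>k. (1/2::real) ^ k < \<epsilon>"
  by (rule real_arch_pow_inv) auto

lemma \<Delta>_local:
  assumes "\<epsilon> > 0"
  shows "\<exists>\<delta>>0. \<forall>y. dist x y < \<delta> \<longrightarrow> \<Delta> x y < \<epsilon>"
proof -
  obtain k where k: "(1/2::real) ^ k < \<epsilon>" using half_power_ex[OF assms] by blast
  have "\<Delta> x y < \<epsilon>" if "dist x y < (1/4) ^ k" for y
    using \<Delta>_less_if_dist[OF that] k path_metric_nonneg[of x y] by simp
  then show ?thesis by (intro exI[of _ "(1/4) ^ k"]) auto
qed

text \<open>At a fixed \<open>x\<close>, (CP2) bounds all products \<open>p x y\<close>; beyond that
  threshold only the metric alternative of the entourage remains. Hence \<open>\<Delta>\<close>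
  separates points and induces the original topology.\<close>

lemma dist_local:
  assumes "\<epsilon> > 0"
  shows "\<exists>\<delta>>0. \<forall>y. \<Delta> x y < \<delta> \<longrightarrow> dist x y < \<epsilon>"
proof -
  obtain j where j: "(1/4::real) ^ j < \<epsilon>"
    using real_arch_pow_inv[OF assms, of "1/4"] by auto
  obtain m where m: "\<rho>2 (dist x0 x) \<le> real m" using real_arch_simple by blast
  define k where "k = max j m"
  have "dist x y < \<epsilon>" if "\<Delta> x y < (1/2) ^ Suc (Suc k)" for y
  proof -
    have "p x y \<le> threshold k"
      using \<rho>2(2)[of x y] m threshold_ge[of k] by (simp add: k_def)
    then have "dist x y < (1/4) ^ k" using \<Delta>_lessD[OF that] by simp
    also have "\<dots> \<le> (1/4) ^ j" by (intro power_decreasing) (auto simp: k_def)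
    finally show ?thesis using j by simp
  qed
  then show ?thesis by (intro exI[of _ "(1/2) ^ Suc (Suc k)"]) auto
qed

sublocale X: Metric_space UNIV \<Delta>
proof
  show "0 \<le> \<Delta> x y" for x y by (rule path_metric_nonneg)
  show "\<Delta> x y = \<Delta> y x" for x y by (rule path_metric_commute)
  show "\<Delta> x z \<le> \<Delta> x y + \<Delta> y z" for x y z by (rule path_metric_triangle)
  show "\<Delta> x y = 0 \<longleftrightarrow> x = y" for x y
  proof
    assume 0: "\<Delta> x y = 0"
    have "dist x y < \<epsilon>" if "\<epsilon> > 0" for \<epsilon>
      using dist_local[OF that, of x] 0 by auto
    then show "x = y" by (meson less_irrefl zero_less_dist_iff)
  next
    assume "x = y"
    then show "\<Delta> x y = 0"
      using path_metric_le[of x x] path_metric_nonneg[of x x] by (simp add: E_refl)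
  qed
qed

lemma mtopology_eq: "X.mtopology = euclidean"
  unfolding topology_eq
proof
  fix S :: "'a set"
  have "openin X.mtopology S \<longleftrightarrow> (\<forall>x\<in>S. \<exists>r>0. \<forall>y. \<Delta> x y < r \<longrightarrow> y \<in> S)"
    unfolding X.openin_mtopology by (auto simp: subset_iff)
  also have "\<dots> \<longleftrightarrow> (\<forall>x\<in>S. \<exists>r>0. \<forall>y. dist x y < r \<longrightarrow> y \<in> S)"
    using \<Delta>_local dist_local by meson
  also have "\<dots> \<longleftrightarrow> openin euclidean S"
    by (simp add: open_dist dist_commute)
  finally show "openin X.mtopology S \<longleftrightarrow> openin euclidean S" .
qed

text \<open>(CP4) brings every point \<open>\<Delta>\<close>-close to a fixed ball. That ball is
  compact by properness, and finitely many small metric balls covering it are small for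
  \<open>\<Delta>\<close> as well.\<close>

lemma totally_bounded: "X.mtotally_bounded UNIV"
  unfolding X.mtotally_bounded_def
proof (intro allI impI)
  fix \<epsilon> :: real assume "\<epsilon> > 0"
  then obtain k where k: "(1/2::real) ^ k < \<epsilon>" using half_power_ex by blast
  \<comment> \<open>(CP4) gives a weak inequality, whereas \<open>threshold k\<close> must be
    exceeded strictly.\<close>
  obtain r where r: "\<And>x. dist x0 x > r \<Longrightarrow> \<exists>y. dist x0 y \<le> r \<and> p x y \<ge> threshold k + 1"
    using p_dense[of "threshold k + 1"] threshold_nonneg[of k] by auto
  have "compact (cball x0 r)" by (rule proper) auto
  then obtain F where F: "finite F" "cball x0 r \<subseteq> (\<Union>z\<in>F. ball z ((1/4) ^ k))"
    unfolding compact_eq_totally_bounded by (meson zero_less_power zero_less_divide_iff zero_less_one zero_less_numeral)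
  have "\<exists>z\<in>F. \<Delta> z x < \<epsilon>" for x
  proof -
    obtain y where y: "dist x0 y \<le> r" "\<Delta> y x < (1/2) ^ Suc k"
    proof (cases "dist x0 x > r")
      case True
      then obtain y where "dist x0 y \<le> r" "p x y \<ge> threshold k + 1" using r by blast
      then show ?thesis
        using that[of y] \<Delta>_less_if_product[of k y x] by (simp add: p_sym)
    next
      case False
      then show ?thesis using that[of x] by simp
    qed
    then obtain z where z: "z \<in> F" "dist z y < (1/4) ^ k" using F(2) by force
    have "\<Delta> z x \<le> \<Delta> z y + \<Delta> y x" by (rule path_metric_triangle)
    also have "\<dots> < (1/2) ^ Suc k + (1/2) ^ Suc k"
      by (intro add_strict_mono \<Delta>_less_if_dist z y)
    also have "\<dots> < \<epsilon>" using k by simp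
    finally show ?thesis using z(1) by blast
  qed
  then show "\<exists>K. finite K \<and> K \<subseteq> UNIV \<and> UNIV \<subseteq> (\<Union>x\<in>K. X.mball x \<epsilon>)"
    using F(1) by (intro exI[of _ F]) auto
qed

text \<open>A large product makes \<open>\<Delta>\<close> small and so equates the limits, while
  (CP2) keeps products bounded near a point of \<open>X\<close>. Conversely, small
  \<open>\<Delta>\<close> means a large product or a small distance; in the second case (CP3)
  applies, because sequences tending to the boundary leave every ball.\<close>

lemma compatible_completion:
  assumes "metric_compactification M D e" and iso: "\<And>x y. D (e x) (e y) = \<Delta> x y"
  shows "product_compatible p (Metric_space.mtopology M D) e"
proof -
  interpret C: metric_compactification M D e by fact
  show ?thesis
    unfolding product_compatible_def
  proof (intro allI impI)
    fix u v a b assume u: "C.conv u a" and v: "C.conv v b"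
    have ab: "a \<in> M" "b \<in> M" using u v C.limitin_mspace by blast+
    have lim: "(\<lambda>i. \<Delta> (u i) (v i)) \<longlonglongrightarrow> D a b"
      using C.tendsto_D[OF u v] by (simp add: iso)
    show "filterlim (\<lambda>i. p (u i) (v i)) at_top sequentially \<longleftrightarrow> a = b \<and> a \<notin> range e"
    proof
      assume p: "filterlim (\<lambda>i. p (u i) (v i)) at_top sequentially"
      have "D a b < \<epsilon>" if "\<epsilon> > 0" for \<epsilon>
      proof -
        obtain k where k: "(1/2::real) ^ k < \<epsilon>" using half_power_ex \<open>\<epsilon> > 0\<close> by blast
        have "\<forall>\<^sub>F i in sequentially. p (u i) (v i) > threshold k"
          using p by (simp add: filterlim_at_top_dense)
        then have "\<forall>\<^sub>F i in sequentially. \<Delta> (u i) (v i) \<le> (1/2) ^ k"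
        proof eventually_elim
          case (elim i)
          have "(1/2::real) ^ Suc k \<le> (1/2) ^ k" by simp
          then show ?case using \<Delta>_less_if_product[OF elim] by linarith
        qed
        then have "D a b \<le> (1/2) ^ k" using tendsto_upperbound[OF lim] by simp
        then show ?thesis using k by simp
      qed
      then have "\<not> D a b > 0" by blast
      then have "a = b" using ab C.mdist_pos_less[of a b] by blast
      moreover have False if x: "a = e x" for x
      proof -
        have "u \<longlonglongrightarrow> x" using u unfolding x C.conv_e_iff .
        then have "(\<lambda>i. dist x0 (u i)) \<longlonglongrightarrow> dist x0 x" by (intro tendsto_intros)
        then have "\<forall>\<^sub>F i in sequentially. dist x0 (u i) < dist x0 x + 1"
          by (rule order_tendstoD) simp
        moreover have "\<forall>\<^sub>F i in sequentially. p (u i) (v i) > \<rho>2 (dist x0 x + 1)"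
          using p by (simp add: filterlim_at_top_dense)
        ultimately have "\<forall>\<^sub>F i in sequentially. False"
        proof eventually_elim
          case (elim i)
          have "\<rho>2 (dist x0 (u i)) \<le> \<rho>2 (dist x0 x + 1)"
            using elim(1) by (intro control_fun_mono[OF \<rho>2(1)]) auto
          then show False using elim(2) \<rho>2(2)[of "u i" "v i"] by simp
        qed
        then show False by simp
      qed
      ultimately show "a = b \<and> a \<notin> range e" by blast
    next
      assume a: "a = b \<and> a \<notin> range e"
      show "filterlim (\<lambda>i. p (u i) (v i)) at_top sequentially"
        unfolding filterlim_at_top
      proof
        fix K :: real
        obtain k where "max K 0 \<le> real k" using real_arch_simple by blast
        then have k: "K \<le> threshold k" using threshold_ge[of k] by simp
        have "(\<lambda>i. \<Delta> (u i) (v i)) \<longlonglongrightarrow> 0" using lim a ab by simp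
        then have "\<forall>\<^sub>F i in sequentially. \<Delta> (u i) (v i) < (1/2) ^ Suc (Suc k)"
          by (rule order_tendstoD) simp
        \<comment> \<open>The maximum keeps the argument of \<open>\<rho>3\<close> in the range
          where it is monotone.\<close>
        moreover have "\<forall>\<^sub>F i in sequentially. dist x0 (u i) > \<rho>3 (max K 0) 1"
          using C.dist_at_top[OF u, of x0] a unfolding filterlim_at_top_dense by blast
        ultimately show "\<forall>\<^sub>F i in sequentially. K \<le> p (u i) (v i)"
        proof eventually_elim
          case (elim i)
          show ?case
          proof (cases "p (u i) (v i) > threshold k")
            case False
            then have "dist (u i) (v i) < (1/4) ^ k" using \<Delta>_lessD[OF elim(1)] by blast
            also have "\<dots> \<le> 1" by (simp add: power_le_one)
            finally show ?thesis
              using product_gt_if_near_far[of "max K 0" "u i" "v i" 1] elim(2) by simp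
          qed (use k in simp)
        qed
      qed
    qed
  qed
qed

text \<open>The dense image is totally bounded, so completeness makes the completion compact; since
  \<open>\<Delta>\<close> metrizes the original topology, the isometry is a topological embedding.
  Points realised as real functions on \<open>X\<close> give one carrier type for all
  products.\<close>

lemma completion_ex:
  "\<exists>(M :: ('a \<Rightarrow> real) set) D e. metric_compactification M D e \<and>
     product_compatible p (Metric_space.mtopology M D) e"
proof -
  obtain e :: "'a \<Rightarrow> 'a \<Rightarrow> real" and m where m: "mcomplete_of m" "e \<in> UNIV \<rightarrow> mspace m"
    "mtopology_of m closure_of e ` UNIV = mspace m" and iso: "\<And>x y. mdist m (e x) (e y) = \<Delta> x y"
    using X.metric_completion by (metis UNIV_I)
  interpret C: Metric_space "mspace m" "mdist m" by simp
  interpret XC: Metric_space12 UNIV \<Delta> "mspace m" "mdist m" by unfold_locales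
  have e_in: "e x \<in> mspace m" for x using m(2) by blast
  have dense: "C.mtopology closure_of range e = mspace m"
    using m(3) by (simp add: mtopology_of_def)
  have "C.mtotally_bounded (range e)"
    unfolding C.mtotally_bounded_def
  proof (intro allI impI)
    fix \<epsilon> :: real assume "\<epsilon> > 0"
    then obtain K where "finite K" "UNIV \<subseteq> (\<Union>x\<in>K. X.mball x \<epsilon>)"
      using totally_bounded unfolding X.mtotally_bounded_def by blast
    then show "\<exists>K. finite K \<and> K \<subseteq> range e \<and> range e \<subseteq> (\<Union>x\<in>K. C.mball x \<epsilon>)"
      using e_in iso by (intro exI[of _ "e ` K"]) (auto simp: subset_iff)
  qed
  then have "C.mtotally_bounded (mspace m)"
    using C.mtotally_bounded_closure_of dense by metis
  moreover have "C.mcomplete" using m(1) by (simp add: mcomplete_of_def)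
  ultimately have "compact_space C.mtopology"
    by (simp add: C.compact_space_eq_mcomplete_mtotally_bounded)
  moreover have "embedding_map euclidean C.mtopology e"
    using XC.isometry_imp_embedding_map[OF m(2)] iso by (simp add: mtopology_eq)
  ultimately have "compactification (C.mtopology, e)"
    by (simp add: compactification_def C.Hausdorff_space_mtopology dense)
  then have "metric_compactification (mspace m) (mdist m) e"
    by unfold_locales (auto intro: proper)
  moreover from this have "product_compatible p C.mtopology e"
    by (rule compatible_completion) (rule iso)
  ultimately show ?thesis by blast
qed

end

lemma controlled_product_imp_compactification:
  fixes x0 :: "'a::metric_space"
  assumes proper: "\<And>S :: 'a set. closed S \<Longrightarrow> bounded S \<Longrightarrow> compact S"
    and p: "controlled_product x0 p"
  shows "\<exists>(M :: ('a \<Rightarrow> real) set) D e. metric_compactification M D e \<and>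
     product_compatible p (Metric_space.mtopology M D) e"
proof -
  obtain \<rho>1 where \<rho>1: "control_fun \<rho>1" "\<forall>x y z. min (p x y) (p y z) \<le> \<rho>1 (p x z)"
    using p unfolding controlled_product_def CP1_def by blast
  obtain \<rho>2 where \<rho>2: "control_fun \<rho>2" "\<forall>x y. p x y \<le> \<rho>2 (dist x0 x)"
    using p unfolding controlled_product_def CP2_def by blast
  have "CP3 x0 p" "CP4 x0 p"
    using p unfolding controlled_product_def by blast+
  then obtain \<rho>3 :: "real \<Rightarrow> real \<Rightarrow> real" where \<rho>3: "(\<forall>s\<ge>0. \<forall>t\<ge>0. \<rho>3 s t \<ge> 0) \<and>
     (\<forall>s1\<ge>0. \<forall>t1\<ge>0. \<forall>s2\<ge>s1. \<forall>t2\<ge>t1. \<rho>3 s1 t1 \<le> \<rho>3 s2 t2) \<and>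
     (\<forall>x y. dist x0 x \<le> \<rho>3 (p x y) (dist x y))"
    unfolding CP3_def by (elim exE)
  obtain \<rho>4 where \<rho>4: "\<forall>R\<ge>0. \<forall>x. dist x0 x > \<rho>4 R \<longrightarrow> (\<exists>y. dist x0 y \<le> \<rho>4 R \<and> p x y \<ge> R)"
    using \<open>CP4 x0 p\<close> unfolding CP4_def by (elim exE conjE)
  have nonneg: "\<forall>x y. p x y \<ge> 0" and sym: "\<forall>x y. p x y = p y x"
    using p unfolding controlled_product_def by blast+
  interpret controlled x0 p \<rho>1 \<rho>2 \<rho>3
  proof
    show "\<exists>r. \<forall>x. dist x0 x > r \<longrightarrow> (\<exists>y. dist x0 y \<le> r \<and> p x y \<ge> R)" if "R \<ge> 0" for R
      using \<rho>4 that by (intro exI[of _ "\<rho>4 R"]) simp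
  qed (use proper nonneg sym \<rho>1 \<rho>2 \<rho>3 in simp_all)
  show ?thesis by (rule completion_ex)
qed

section \<open>The Higson compactification\<close>

text \<open>The closure of the partial graph is compact and projects bijectively onto \<open>H\<close>, hence is the
  graph of a continuous map.\<close>

lemma continuous_extension_if_closure_functional:
  fixes H :: "'h topology" and T :: "'t topology" and h :: "'x \<Rightarrow> 'h" and e :: "'x \<Rightarrow> 't"
  assumes H: "compact_space H" "Hausdorff_space H" and T: "compact_space T"
    and h: "\<And>x. h x \<in> topspace H" "H closure_of range h = topspace H" and e: "\<And>x. e x \<in> topspace T"
    and functional: "\<And>w a b. (w, a) \<in> prod_topology H T closure_of range (\<lambda>x. (h x, e x)) \<Longrightarrow>
      (w, b) \<in> prod_topology H T closure_of range (\<lambda>x. (h x, e x)) \<Longrightarrow> a = b"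
  obtains f where "continuous_map H T f" "\<And>x. f (h x) = e x"
proof -
  define G where "G = prod_topology H T closure_of range (\<lambda>x. (h x, e x))"
  define S where "S = subtopology (prod_topology H T) G"
  have "compact_space (prod_topology H T)"
    using H(1) T by (simp add: compact_space_prod_topology)
  then have "compactin (prod_topology H T) G"
    unfolding G_def by (intro closedin_compact_space) simp_all
  then have compact: "compact_space S"
    unfolding S_def by (rule compact_space_subtopology)
  have G_sub: "G \<subseteq> topspace (prod_topology H T)"
    unfolding G_def by (rule closure_of_subset_topspace)
  then have top: "topspace S = G" by (auto simp: S_def)
  have in_G: "(h x, e x) \<in> G" for x
    unfolding G_def using h(1) e closure_of_subset[of "range (\<lambda>x. (h x, e x))" "prod_topology H T"]
    by (auto simp: image_subset_iff)
  have cont: "continuous_map S H fst"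
    unfolding S_def by (intro continuous_map_from_subtopology continuous_map_fst)
  \<comment> \<open>The projection of the compact set \<open>G\<close> is closed in the Hausdorff
    space \<open>H\<close> and contains the dense range of \<open>h\<close>, so it is
    everything.\<close>
  have "closedin H (fst ` G)"
    using image_compactin[OF _ cont, of G] compact top H(2) compactin_imp_closedin
    by (metis compact_space_def)
  moreover have "range h \<subseteq> fst ` G"
    using in_G by force
  ultimately have "topspace H \<subseteq> fst ` G"
    using closure_of_minimal[of "range h" "fst ` G" H] h(2) by simp
  then have surj: "fst ` topspace S = topspace H"
    using G_sub top by auto
  have "inj_on fst (topspace S)"
    unfolding top using functional by (auto simp: inj_on_def G_def)
  then have "homeomorphic_map S H fst"
    using cont compact H(2) surj by (intro continuous_imp_homeomorphic_map)
  then obtain g where g: "homeomorphic_maps S H fst g"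
    using homeomorphic_map_maps by blast
  have "continuous_map S T snd"
    unfolding S_def by (intro continuous_map_from_subtopology continuous_map_snd)
  then have "continuous_map H T (snd \<circ> g)"
    using g by (auto simp: homeomorphic_maps_def intro: continuous_map_compose)
  moreover have "(snd \<circ> g) (h x) = e x" for x
  proof -
    have "g (fst (h x, e x)) = (h x, e x)"
      using g in_G[of x] top unfolding homeomorphic_maps_def by blast
    then show ?thesis by simp
  qed
  ultimately show ?thesis by (rule that)
qed

section \<open>The evaluation model of the Higson compactification\<close>

lemma higson_function_bump:
  fixes x :: "'a::metric_space"
  shows "higson_function (\<lambda>y. complex_of_real (max 0 (r - dist x y)))"
  unfolding higson_function_def
proof (intro conjI allI impI)
  show "bounded (range (\<lambda>y. complex_of_real (max 0 (r - dist x y))))"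
  proof (rule boundedI[of _ "\<bar>r\<bar>"])
    fix z assume "z \<in> range (\<lambda>y. complex_of_real (max 0 (r - dist x y)))"
    then obtain y where z: "z = complex_of_real (max 0 (r - dist x y))" by blast
    have "\<bar>max 0 (r - dist x y)\<bar> \<le> \<bar>r\<bar>" using zero_le_dist[of x y] by linarith
    then show "norm z \<le> \<bar>r\<bar>" unfolding z norm_of_real .
  qed
  show "continuous_on UNIV (\<lambda>y. complex_of_real (max 0 (r - dist x y)))"
    by (intro continuous_intros)
  fix \<epsilon> R :: real assume "\<epsilon> > 0"
  then show "\<exists>B. bounded B \<and> (\<forall>y\<in>-B. \<forall>z\<in>-B. dist y z < R \<longrightarrow>
      cmod (complex_of_real (max 0 (r - dist x y)) - complex_of_real (max 0 (r - dist x z))) < \<epsilon>)"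
    \<comment> \<open>Outside this ball both values are 0.\<close>
    by (intro exI[of _ "cball x r"]) (auto simp: not_le)
qed

lemma higson_function_vanishing:
  assumes f: "higson_function f" and \<epsilon>: "\<epsilon> > 0"
  shows "\<exists>n::nat. \<forall>x y. dist x0 x \<ge> real n \<longrightarrow> dist x0 y \<ge> real n \<longrightarrow> dist x y < R \<longrightarrow> cmod (f x - f y) < \<epsilon>"
proof -
  \<comment> \<open>The definition of a Higson function asks for a positive radius, while
    \<open>R\<close> is arbitrary here.\<close>
  obtain B where B: "bounded B" "\<forall>x\<in>-B. \<forall>y\<in>-B. dist x y < max R 1 \<longrightarrow> cmod (f x - f y) < \<epsilon>"
    using f \<epsilon> unfolding higson_function_def by (metis less_max_iff_disj zero_less_one)
  obtain r where r: "B \<subseteq> cball x0 r"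
    using B(1) unfolding bounded_any_center[of B x0] by (auto simp: subset_iff)
  obtain n where n: "r < real n" using reals_Archimedean2 by blast
  have "x \<in> -B" if "dist x0 x \<ge> real n" for x
    using r n that by auto
  then show ?thesis using B(2) by (intro exI[of _ n]) auto
qed

text \<open>Restriction to the index set makes each value a point of the product, whose elements are
  extensional.\<close>

definition higson_eval :: "'a::metric_space \<Rightarrow> (('a \<Rightarrow> complex) \<Rightarrow> complex)" where
  "higson_eval x = (\<lambda>f\<in>Collect higson_function. f x)"

definition higson_product :: "(('a::metric_space \<Rightarrow> complex) \<Rightarrow> complex) topology" where
  "higson_product = product_topology (\<lambda>_. euclidean) (Collect higson_function)"

definition higson_topology :: "(('a::metric_space \<Rightarrow> complex) \<Rightarrow> complex) topology" where
  "higson_topology = subtopology higson_product (higson_product closure_of range higson_eval)"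

lemma higson_eval_apply: "higson_function f \<Longrightarrow> higson_eval x f = f x"
  by (simp add: higson_eval_def)

lemma higson_eval_in_product: "higson_eval x \<in> topspace higson_product"
  by (simp add: higson_product_def higson_eval_def)

lemma topspace_higson: "topspace higson_topology = higson_product closure_of range higson_eval"
  unfolding higson_topology_def using closure_of_subset_topspace[of higson_product] by auto

lemma higson_eval_in: "higson_eval x \<in> topspace higson_topology"
  unfolding topspace_higson using closure_of_subset[of "range higson_eval" higson_product] higson_eval_in_product by blast

lemma Hausdorff_higson: "Hausdorff_space higson_topology"
  unfolding higson_topology_def higson_product_def
  by (intro Hausdorff_space_subtopology) (simp add: Hausdorff_space_product_topology)

lemma dense_higson:
  "higson_topology closure_of range (higson_eval :: 'a::metric_space \<Rightarrow> _) = topspace higson_topology"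
proof -
  have "range (higson_eval :: 'a \<Rightarrow> _) \<subseteq> higson_product closure_of range higson_eval"
    using higson_eval_in unfolding topspace_higson by blast
  then show ?thesis
    unfolding topspace_higson unfolding higson_topology_def closure_of_subtopology
    by (simp add: Int_absorb1)
qed

text \<open>Higson functions are bounded, so all evaluations lie in a product of closed discs, which
  is compact by Tychonoff.\<close>

lemma compact_higson: "compact_space (higson_topology :: (('a::metric_space \<Rightarrow> complex) \<Rightarrow> complex) topology)"
proof -
  have "\<exists>b. \<forall>x. cmod (f x) \<le> b" if "higson_function f" for f :: "'a \<Rightarrow> complex"
    using that unfolding higson_function_def bounded_iff by auto
  then have "\<exists>b. higson_function f \<longrightarrow> (\<forall>x. cmod (f x) \<le> b)" for f :: "'a \<Rightarrow> complex"
    by blast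
  then obtain b where b: "\<And>(f :: 'a \<Rightarrow> complex) x. higson_function f \<Longrightarrow> cmod (f x) \<le> b f"
    by metis
  define K where "K = PiE (Collect higson_function) (\<lambda>f :: 'a \<Rightarrow> complex. cball (0::complex) (b f))"
  have K: "compactin higson_product K"
    unfolding higson_product_def K_def compactin_PiE by simp
  have "closedin higson_product K"
    using K unfolding higson_product_def by (intro compactin_imp_closedin) (simp_all add: Hausdorff_space_product_topology)
  moreover have "range (higson_eval :: 'a \<Rightarrow> _) \<subseteq> K"
  proof (rule image_subsetI)
    fix x :: 'a
    show "higson_eval x \<in> K"
      unfolding K_def higson_eval_def by (intro PiE_I) (simp_all add: b)
  qed
  ultimately have "higson_product closure_of range higson_eval \<subseteq> K"
    by (intro closure_of_minimal)
  then show ?thesis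
    unfolding higson_topology_def
    by (intro compact_space_subtopology closed_compactin[OF K]) simp_all
qed

lemma continuous_higson_coordinate:
  "higson_function f \<Longrightarrow> continuous_map higson_topology euclidean (\<lambda>w. w f)"
  unfolding higson_topology_def higson_product_def
  by (intro continuous_map_from_subtopology continuous_map_product_projection) simp

lemma continuous_higson_eval: "continuous_map euclidean higson_topology (higson_eval :: 'a::metric_space \<Rightarrow> _)"
  unfolding higson_topology_def
proof (rule continuous_map_into_subtopology)
  show "continuous_map euclidean higson_product higson_eval"
    unfolding higson_product_def continuous_map_componentwise
    by (auto simp: higson_eval_def higson_function_def)
  show "higson_eval \<in> topspace euclidean \<rightarrow> higson_product closure_of range higson_eval"
    using higson_eval_in unfolding topspace_higson by blast
qed

text \<open>Bump functions are Higson functions vanishing outside a prescribed small ball. They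
  separate points, and their nonvanishing sets provide the required open neighbourhoods in the
  image.\<close>

lemma embedding_higson_eval: "embedding_map euclidean higson_topology (higson_eval :: 'a::metric_space \<Rightarrow> _)"
proof -
  let ?R = "subtopology higson_topology (range (higson_eval :: 'a \<Rightarrow> _))"
  have separate: "\<exists>f. higson_function f \<and> f x \<noteq> 0 \<and> (\<forall>y. f y \<noteq> 0 \<longrightarrow> y \<in> W)" if W: "open W" "x \<in> W" for x :: 'a and W
  proof -
    obtain r where r: "r > 0" "ball x r \<subseteq> W" using W openE by blast
    then show ?thesis
      using higson_function_bump[of r x]
      by (intro exI[of _ "\<lambda>y. complex_of_real (max 0 (r - dist x y))"]) (auto simp: max_def split: if_splits)
  qed
  have inj: "inj (higson_eval :: 'a \<Rightarrow> _)"
  proof (rule injI, rule ccontr)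
    fix x y :: 'a assume eq: "higson_eval x = higson_eval y" and "x \<noteq> y"
    then obtain f where f: "higson_function f" "f x \<noteq> 0" "\<forall>z. f z \<noteq> 0 \<longrightarrow> z \<in> - {y}"
      using separate[of "- {y}" x] by auto
    then have "f x = f y" using eq by (metis higson_eval_apply)
    then show False using f by auto
  qed
  have "open_map euclidean ?R higson_eval"
    unfolding open_map_def
  proof (intro allI impI)
    fix W :: "'a set" assume "openin euclidean W"
    then have W: "open W" by simp
    show "openin ?R (higson_eval ` W)"
    proof (subst openin_subopen, intro ballI)
      fix w assume "w \<in> higson_eval ` W"
      then obtain x where x: "x \<in> W" "w = higson_eval x" by blast
      obtain f where f: "higson_function f" "f x \<noteq> 0" "\<forall>y. f y \<noteq> 0 \<longrightarrow> y \<in> W"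
        using separate[OF W x(1)] by blast
      have "openin higson_topology {w \<in> topspace higson_topology. w f \<in> - {0}}"
        by (intro openin_continuous_map_preimage[OF continuous_higson_coordinate[OF f(1)]]) auto
      then have "openin ?R (range higson_eval \<inter> {w \<in> topspace higson_topology. w f \<in> - {0}})"
        by (rule openin_subtopology_Int2)
      moreover have "w \<in> range higson_eval \<inter> {w \<in> topspace higson_topology. w f \<in> - {0}}"
        using x f higson_eval_in by (auto simp: higson_eval_apply)
      moreover have "range higson_eval \<inter> {w \<in> topspace higson_topology. w f \<in> - {0}} \<subseteq> higson_eval ` W"
        using f by (auto simp: higson_eval_apply)
      ultimately show "\<exists>V. openin ?R V \<and> w \<in> V \<and> V \<subseteq> higson_eval ` W" by blast
    qed
  qed
  moreover have "continuous_map euclidean ?R higson_eval"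
    using continuous_higson_eval by (rule continuous_map_into_subtopology) auto
  ultimately have "embedding_map euclidean ?R higson_eval"
    using inj by (intro injective_open_imp_embedding_map) auto
  then show ?thesis
    by (simp add: embedding_map_in_subtopology)
qed

text \<open>Otherwise pairs of points far out with bounded distance, on which \<open>g\<close> differs by \<open>\<epsilon>\<close>, have a
  cluster point \<open>(a, b)\<close>; all Higson functions agree at \<open>a\<close> and \<open>b\<close>, so \<open>a = b\<close>.\<close>

lemma higson_function_restriction:
  assumes g: "continuous_map higson_topology (euclidean :: complex topology) g"
  shows "higson_function (g \<circ> higson_eval :: 'a::metric_space \<Rightarrow> complex)"
  unfolding higson_function_def
proof (intro conjI allI impI)
  have "compactin (euclidean :: complex topology) (g ` topspace higson_topology)"
    using compact_higson image_compactin[OF _ g] unfolding compact_space_def by blast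
  then have "bounded (g ` topspace higson_topology)"
    by (simp add: compact_imp_bounded)
  then show "bounded (range (g \<circ> higson_eval))"
    by (rule bounded_subset) (use higson_eval_in in auto)
  show "continuous_on UNIV (g \<circ> higson_eval)"
    using continuous_map_compose[OF continuous_higson_eval g] by simp
  fix \<epsilon> R :: real assume \<epsilon>: "\<epsilon> > 0"
  let ?HH = "prod_topology higson_topology higson_topology :: ((('a \<Rightarrow> complex) \<Rightarrow> complex) \<times> (('a \<Rightarrow> complex) \<Rightarrow> complex)) topology"
  have closed_le: "closedin ?HH {z \<in> topspace ?HH. cmod (k (fst z) - k (snd z)) \<in> C}"
    if k: "continuous_map higson_topology euclidean k" and C: "closed C" for k and C :: "real set"
  proof (rule closedin_continuous_map_preimage)
    have "continuous_map ?HH euclidean (\<lambda>z. k (fst z) - k (snd z))"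
      using continuous_map_compose[OF continuous_map_fst k] continuous_map_compose[OF continuous_map_snd k]
      by (intro continuous_map_diff) (simp_all add: comp_def)
    moreover have "continuous_map euclidean euclidean cmod"
      by (simp add: continuous_on_norm_id)
    ultimately have "continuous_map ?HH euclidean (cmod \<circ> (\<lambda>z. k (fst z) - k (snd z)))"
      by (rule continuous_map_compose)
    then show "continuous_map ?HH euclidean (\<lambda>z. cmod (k (fst z) - k (snd z)))"
      by (simp add: comp_def)
  qed (use C in simp)
  show "\<exists>B. bounded B \<and> (\<forall>x\<in>-B. \<forall>y\<in>-B. dist x y < R \<longrightarrow>
      cmod ((g \<circ> higson_eval) x - (g \<circ> higson_eval) y) < \<epsilon>)"
  proof (rule ccontr)
    assume contra: "\<not> ?thesis"
    define x0 :: 'a where "x0 = undefined"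
    have "\<exists>x y. dist x0 x \<ge> real n \<and> dist x0 y \<ge> real n \<and> dist x y < R \<and>
        cmod (g (higson_eval x) - g (higson_eval y)) \<ge> \<epsilon>" for n
    proof -
      have "\<not> (\<forall>x\<in>-ball x0 (real n). \<forall>y\<in>-ball x0 (real n). dist x y < R \<longrightarrow>
          cmod ((g \<circ> higson_eval) x - (g \<circ> higson_eval) y) < \<epsilon>)"
        using contra bounded_ball by blast
      then obtain x y where "x \<in> -ball x0 (real n)" "y \<in> -ball x0 (real n)" "dist x y < R"
        "\<not> cmod ((g \<circ> higson_eval) x - (g \<circ> higson_eval) y) < \<epsilon>" by blast
      then show ?thesis by (intro exI[of _ x] exI[of _ y]) auto
    qed
    then obtain x y where xy: "\<And>n. dist x0 (x n) \<ge> real n" "\<And>n. dist x0 (y n) \<ge> real n"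
      "\<And>n. dist (x n) (y n) < R" "\<And>n. cmod (g (higson_eval (x n)) - g (higson_eval (y n))) \<ge> \<epsilon>"
      by metis
    \<comment> \<open>The model need not be sequentially compact, so the cluster point is found in
      the nested closures of the tails.\<close>
    define A where "A n = (\<lambda>m. (higson_eval (x m), higson_eval (y m))) ` {n..}" for n
    have A_sub: "A n \<subseteq> topspace ?HH" for n
      using higson_eval_in by (auto simp: A_def)
    have "(\<Inter>n. ?HH closure_of A n) \<noteq> {}"
    proof (rule compact_space_imp_nest)
      show "compact_space ?HH"
        by (simp add: compact_space_prod_topology compact_higson)
      show "?HH closure_of A n \<noteq> {}" for n
        using closure_of_subset[OF A_sub[of n]] by (auto simp: A_def)
      show "decseq (\<lambda>n. ?HH closure_of A n)"
        by (intro decseq_SucI closure_of_mono) (auto simp: A_def)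
    qed simp
    then obtain a b where ab: "\<And>n. (a, b) \<in> ?HH closure_of A n" by auto
    have in_closed: "cmod (k a - k b) \<in> C"
      if k: "continuous_map higson_topology euclidean k" and C: "closed C"
        and N: "\<And>m. m \<ge> N \<Longrightarrow> cmod (k (higson_eval (x m)) - k (higson_eval (y m))) \<in> C"
      for k N and C :: "real set"
    proof -
      have "A N \<subseteq> {z \<in> topspace ?HH. cmod (k (fst z) - k (snd z)) \<in> C}"
        using A_sub[of N] N by (auto simp: A_def)
      from closure_of_minimal[OF this closed_le[OF k C]]
      show ?thesis using ab[of N] by auto
    qed
    have "a f = b f" if f: "higson_function f" for f
    proof -
      have "cmod (a f - b f) \<le> 0 + \<delta>" if \<delta>: "\<delta> > 0" for \<delta>
      proof -
        obtain N :: nat where N: "\<And>x y. dist x0 x \<ge> real N \<Longrightarrow> dist x0 y \<ge> real N \<Longrightarrow> dist x y < R \<Longrightarrow> cmod (f x - f y) < \<delta>"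
          using higson_function_vanishing[OF f \<delta>] by blast
        have "cmod (f (x m) - f (y m)) \<le> \<delta>" if "m \<ge> N" for m
        proof (rule less_imp_le, rule N[OF _ _ xy(3)])
          show "real N \<le> dist x0 (x m)" using xy(1)[of m] that by linarith
          show "real N \<le> dist x0 (y m)" using xy(2)[of m] that by linarith
        qed
        then show ?thesis
          using in_closed[OF continuous_higson_coordinate[OF f], of "{..\<delta>}" N] f
          by (simp add: higson_eval_apply)
      qed
      then have "cmod (a f - b f) \<le> 0" by (rule field_le_epsilon)
      then show ?thesis by simp
    qed
    moreover have "a \<in> topspace higson_product" "b \<in> topspace higson_product"
      using ab[of 0] closure_of_subset_topspace[of ?HH "A 0"] closure_of_subset_topspace[of higson_product "range higson_eval"]
      by (auto simp: topspace_higson)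
    ultimately have "a = b"
      by (auto simp: higson_product_def PiE_def intro: extensionalityI)
    moreover have "cmod (g a - g b) \<in> {\<epsilon>..}"
      using xy(4) by (intro in_closed[OF g, of _ 0]) auto
    ultimately show False using \<epsilon> by simp
  qed
qed

text \<open>Density of \<open>X\<close> makes restriction injective, and a Higson function
  \<open>f\<close> extends by the coordinate projection at \<open>f\<close>.\<close>

lemma higson_compactification_higson_topology:
  "higson_compactification (higson_topology, higson_eval :: 'a::metric_space \<Rightarrow> _)"
proof -
  let ?C = "{g \<in> extensional (topspace higson_topology). continuous_map (higson_topology :: (('a \<Rightarrow> complex) \<Rightarrow> complex) topology) (euclidean :: complex topology) g}"
  have "compactification (higson_topology, higson_eval :: 'a \<Rightarrow> _)"
    using compact_higson Hausdorff_higson embedding_higson_eval dense_higson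
    by (simp add: compactification_def)
  moreover have "inj_on (\<lambda>g. g \<circ> higson_eval) ?C"
  proof (rule inj_onI)
    fix g k assume g: "g \<in> ?C" and k: "k \<in> ?C" and eq: "g \<circ> higson_eval = k \<circ> higson_eval"
    have "g w = k w" if "w \<in> topspace higson_topology" for w
    proof (rule forall_in_closure_of_eq[of w higson_topology "range higson_eval" euclidean g k])
      show "w \<in> higson_topology closure_of range higson_eval"
        using that by (simp add: dense_higson)
      show "continuous_map higson_topology euclidean g" "continuous_map higson_topology euclidean k"
        using g k by auto
      show "g w = k w" if "w \<in> range higson_eval" for w
        using that eq by (auto simp: fun_eq_iff)
    qed simp
    then show "g = k"
      using g k by (auto intro: extensionalityI)
  qed
  moreover have "(\<lambda>g. g \<circ> higson_eval) ` ?C = {f. higson_function f}"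
  proof (intro equalityI subsetI)
    fix f :: "'a \<Rightarrow> complex" assume "f \<in> {f. higson_function f}"
    then have f: "higson_function f" by simp
    let ?g = "restrict (\<lambda>w. w f) (topspace higson_topology)"
    have "continuous_map higson_topology euclidean ?g"
      using continuous_higson_coordinate[OF f] by (rule continuous_map_eq) simp
    moreover have "f = ?g \<circ> higson_eval"
      using higson_eval_in by (auto simp: fun_eq_iff higson_eval_apply[OF f])
    ultimately show "f \<in> (\<lambda>g. g \<circ> higson_eval) ` ?C"
      by (intro image_eqI[of _ _ ?g]) auto
  qed (use higson_function_restriction in auto)
  ultimately show ?thesis
    by (simp add: higson_compactification_def bij_betw_def)
qed

section \<open>Higson functions and coarseness of a metric compactification\<close>

context metric_compactification
begin

lemma continuous_D: "a \<in> M \<Longrightarrow> continuous_map mtopology euclidean (\<lambda>z. complex_of_real (D a z))"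
proof -
  assume a: "a \<in> M"
  have "continuous_map mtopology euclidean (\<lambda>z. D a z)"
    using continuous_map_mdist[of mtopology Self "\<lambda>_. a" "\<lambda>z. z"] a
    by (simp add: mtopology_of_def)
  moreover have "continuous_map euclidean euclidean complex_of_real"
    by (simp add: continuous_on_of_real_id)
  ultimately have "continuous_map mtopology euclidean (complex_of_real \<circ> (\<lambda>z. D a z))"
    by (rule continuous_map_compose)
  then show ?thesis by (simp add: comp_def)
qed

text \<open>Otherwise pairs at bounded distance would escape while \<open>g\<close> separates them.
  (CP3) makes their products diverge, compatibility gives subsequences a common limit, and
  continuity of \<open>g\<close> contradicts the separation.\<close>

lemma higson_function_compatible:
  assumes p: "product_compatible p mtopology e" and CP3: "CP3 x0 p" and nonneg: "\<And>x y. p x y \<ge> 0"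
    and g: "continuous_map mtopology (euclidean :: complex topology) g"
  shows "higson_function (g \<circ> e)"
  unfolding higson_function_def
proof (intro conjI allI impI)
  have "compactin (euclidean :: complex topology) (g ` M)"
    using compact_space image_compactin[OF _ g] unfolding compact_space_def by simp
  then have "bounded (g ` M)"
    by (simp add: compact_imp_bounded)
  then show "bounded (range (g \<circ> e))"
    by (rule bounded_subset) auto
  show "continuous_on UNIV (g \<circ> e)"
    using continuous_map_compose[OF continuous_e g] by simp
  fix \<epsilon> R :: real assume \<epsilon>: "\<epsilon> > 0" and "R > 0"
  show "\<exists>B. bounded B \<and> (\<forall>x\<in>-B. \<forall>y\<in>-B. dist x y < R \<longrightarrow> cmod ((g \<circ> e) x - (g \<circ> e) y) < \<epsilon>)"
  proof (rule ccontr)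
    assume contra: "\<not> ?thesis"
    have "\<exists>x y. dist x0 x \<ge> real n \<and> dist x y < R \<and> cmod (g (e x) - g (e y)) \<ge> \<epsilon>" for n
    proof -
      have "\<not> (\<forall>x\<in>-ball x0 (real n). \<forall>y\<in>-ball x0 (real n). dist x y < R \<longrightarrow>
          cmod ((g \<circ> e) x - (g \<circ> e) y) < \<epsilon>)"
        using contra bounded_ball by blast
      then obtain x y where "x \<in> -ball x0 (real n)" "y \<in> -ball x0 (real n)" "dist x y < R"
        "\<not> cmod ((g \<circ> e) x - (g \<circ> e) y) < \<epsilon>" by blast
      then show ?thesis by (intro exI[of _ x] exI[of _ y]) auto
    qed
    then obtain x y where xy: "\<And>n. dist x0 (x n) \<ge> real n" "\<And>n. dist (x n) (y n) < R"
      "\<And>n. cmod (g (e (x n)) - g (e (y n))) \<ge> \<epsilon>"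
      by metis
    obtain \<rho> :: "real \<Rightarrow> real \<Rightarrow> real" where \<rho>: "\<forall>s1\<ge>0. \<forall>t1\<ge>0. \<forall>s2\<ge>s1. \<forall>t2\<ge>t1. \<rho> s1 t1 \<le> \<rho> s2 t2"
      "\<forall>x y. dist x0 x \<le> \<rho> (p x y) (dist x y)"
      using CP3 unfolding CP3_def by (elim exE conjE)
    have "filterlim (\<lambda>n. p (x n) (y n)) at_top sequentially"
      unfolding filterlim_at_top
    proof
      fix K :: real
      obtain N where N: "\<rho> (max K 0) R < real N" using reals_Archimedean2 by blast
      have "K \<le> p (x n) (y n)" if "n \<ge> N" for n
      proof (rule ccontr)
        assume "\<not> ?thesis"
        then have "\<rho> (p (x n) (y n)) (dist (x n) (y n)) \<le> \<rho> (max K 0) R"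
          using \<rho>(1) nonneg[of "x n" "y n"] xy(2)[of n] by simp
        moreover have "dist x0 (x n) \<ge> real N"
          using xy(1)[of n] that by linarith
        ultimately show False
          using \<rho>(2)[rule_format, of "x n" "y n"] N by linarith
      qed
      then show "\<forall>\<^sub>F n in sequentially. K \<le> p (x n) (y n)"
        unfolding eventually_sequentially by blast
    qed
    note lim = this
    obtain r a b where r: "strict_mono r" "conv (x \<circ> r) a" "conv (y \<circ> r) b"
      by (rule conv_subseq2_ex)
    have "filterlim (\<lambda>n. p ((x \<circ> r) n) ((y \<circ> r) n)) at_top sequentially"
      using filterlim_compose[OF lim filterlim_subseq[OF r(1)]] by simp
    then have "a = b" using product_compatibleD[OF p r(2,3)] by blast
    have "(\<lambda>n. g (e (x (r n)))) \<longlonglongrightarrow> g a" "(\<lambda>n. g (e (y (r n)))) \<longlonglongrightarrow> g b"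
      using continuous_map_limit[OF g r(2)] continuous_map_limit[OF g r(3)] by (simp_all add: comp_def)
    then have "(\<lambda>n. cmod (g (e (x (r n))) - g (e (y (r n))))) \<longlonglongrightarrow> cmod (g a - g b)"
      by (intro tendsto_intros)
    then have "\<epsilon> \<le> cmod (g a - g b)"
      using xy(3) by (intro tendsto_lowerbound) auto
    then show False using \<epsilon> \<open>a = b\<close> by simp
  qed
qed

text \<open>On the graph closure the coordinate of \<open>w\<close> at \<open>g \<circ> e\<close>
  equals \<open>g a\<close> for each continuous \<open>g\<close>, since it does so on the graph.
  Taking for \<open>g\<close> the distance to \<open>a\<close> shows that \<open>w\<close>
  determines \<open>a\<close>, as the extension lemma requires.\<close>

lemma coarse_compactification_if_compatible:
  assumes p: "product_compatible p mtopology e" and CP3: "CP3 x0 p" and nonneg: "\<And>x y. p x y \<ge> 0"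
  shows "coarse_compactification (mtopology, e)"
proof -
  define HT where "HT = prod_topology (higson_topology :: (('a \<Rightarrow> complex) \<Rightarrow> complex) topology) mtopology"
  define G where "G = HT closure_of range (\<lambda>x. (higson_eval x, e x))"
  have coord: "w (g \<circ> e) = g a"
    if wa: "(w, a) \<in> G" and g: "continuous_map mtopology (euclidean :: complex topology) g" for w a g
  proof -
    have gh: "higson_function (g \<circ> e)"
      using higson_function_compatible[OF p CP3 nonneg g] .
    have "continuous_map HT euclidean (\<lambda>z. fst z (g \<circ> e))" "continuous_map HT euclidean (\<lambda>z. g (snd z))"
      using continuous_map_compose[OF continuous_map_fst continuous_higson_coordinate[OF gh]]
        continuous_map_compose[OF continuous_map_snd g]
      by (simp_all add: comp_def HT_def)
    then have "fst (w, a) (g \<circ> e) = g (snd (w, a))"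
      by (rule forall_in_closure_of_eq[OF wa[unfolded G_def] Hausdorff_space_euclidean])
        (auto simp: higson_eval_apply[OF gh])
    then show ?thesis by simp
  qed
  have functional: "a = b" if "(w, a) \<in> G" "(w, b) \<in> G" for w a b
  proof -
    have ab: "a \<in> M" "b \<in> M"
      using that closure_of_subset_topspace[of HT] unfolding G_def HT_def by fastforce+
    have "complex_of_real (D a a) = complex_of_real (D a b)"
      using coord[OF that(1) continuous_D[OF ab(1)]] coord[OF that(2) continuous_D[OF ab(1)]] by simp
    then show ?thesis using ab by simp
  qed
  obtain f where "continuous_map higson_topology mtopology f" "\<And>x. f (higson_eval x) = e x"
  proof (rule continuous_extension_if_closure_functional[of higson_topology mtopology higson_eval e])
    show "compact_space (higson_topology :: (('a \<Rightarrow> complex) \<Rightarrow> complex) topology)"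
      by (rule compact_higson)
    show "Hausdorff_space (higson_topology :: (('a \<Rightarrow> complex) \<Rightarrow> complex) topology)"
      by (rule Hausdorff_higson)
    show "compact_space mtopology" by (rule compact_space)
    show "higson_eval x \<in> topspace higson_topology" for x :: 'a by (rule higson_eval_in)
    show "higson_topology closure_of range higson_eval = topspace (higson_topology :: (('a \<Rightarrow> complex) \<Rightarrow> complex) topology)"
      by (rule dense_higson)
    show "e x \<in> topspace mtopology" for x by simp
  qed (use functional in \<open>auto simp: G_def HT_def\<close>)
  then show ?thesis
    unfolding coarse_compactification_def
    using compactification metrizable_space_mtopology higson_compactification_higson_topology by blast
qed

text \<open>Pulling continuous functions back along the map from the Higson compactification shows
  that their restrictions to \<open>X\<close> are Higson functions. For the distance to the limit
  \<open>a\<close> of one of two violating sequences, this forces the other limit to be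
  \<open>a\<close> too.\<close>

lemma slow_if_coarse_compactification:
  assumes coarse: "coarse_compactification (mtopology, e)" and \<epsilon>: "\<epsilon> > 0"
  shows "\<exists>K. \<forall>x y. K \<le> dist x0 x \<longrightarrow> dist x y \<le> R \<longrightarrow> D (e x) (e y) < \<epsilon>"
proof -
  obtain H :: "(('a \<Rightarrow> complex) \<Rightarrow> complex) topology" and h f where
    H: "higson_compactification (H, h)" and f: "continuous_map H mtopology f" "\<And>x. f (h x) = e x"
    using coarse unfolding coarse_compactification_def by auto
  have h_in: "h x \<in> topspace H" for x
  proof -
    have "continuous_map euclidean H h"
      using H unfolding higson_compactification_def compactification_def embedding_map_def
      by (auto dest: homeomorphic_imp_continuous_map intro: continuous_map_into_fulltopology)
    then show ?thesis by (auto simp: continuous_map_def)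
  qed
  have higson: "higson_function (g \<circ> e)" if g: "continuous_map mtopology (euclidean :: complex topology) g" for g
  proof -
    let ?g = "restrict (g \<circ> f) (topspace H)"
    have "continuous_map H euclidean ?g"
      using continuous_map_compose[OF f(1) g] by (rule continuous_map_eq) simp
    then have "?g \<circ> h \<in> {f. higson_function f}"
      using H unfolding higson_compactification_def bij_betw_def by auto
    moreover have "?g \<circ> h = g \<circ> e"
      using h_in f(2) by (auto simp: fun_eq_iff)
    ultimately show ?thesis by simp
  qed
  show ?thesis
  proof (rule ccontr)
    assume contra: "\<not> ?thesis"
    have "\<exists>x y. dist x0 x \<ge> real n \<and> dist x y \<le> R \<and> D (e x) (e y) \<ge> \<epsilon>" for n
      using contra[simplified, rule_format, of "real n"] by (auto simp: not_less)
    then obtain x y where xy: "\<And>n. dist x0 (x n) \<ge> real n" "\<And>n. dist (x n) (y n) \<le> R"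
      "\<And>n. D (e (x n)) (e (y n)) \<ge> \<epsilon>"
      by metis
    obtain r a b where r: "strict_mono r" "conv (x \<circ> r) a" "conv (y \<circ> r) b"
      by (rule conv_subseq2_ex)
    have ab: "a \<in> M" "b \<in> M" using r limitin_mspace by blast+
    define g where "g z = complex_of_real (D a z)" for z
    have g: "continuous_map mtopology euclidean g"
      unfolding g_def using continuous_D[OF ab(1)] .
    have "(\<lambda>n. g (e (x (r n)))) \<longlonglongrightarrow> g a" "(\<lambda>n. g (e (y (r n)))) \<longlonglongrightarrow> g b"
      using continuous_map_limit[OF g r(2)] continuous_map_limit[OF g r(3)] by (simp_all add: comp_def)
    then have lim: "(\<lambda>n. cmod (g (e (x (r n))) - g (e (y (r n))))) \<longlonglongrightarrow> cmod (g a - g b)"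
      by (intro tendsto_intros)
    have "cmod (g a - g b) \<le> 0 + \<eta>" if \<eta>: "\<eta> > 0" for \<eta>
    proof -
      \<comment> \<open>The radius \<open>R + 1\<close> turns the weak bound on the distance into a
        strict one.\<close>
      obtain N :: nat where N: "\<And>x y. dist x0 x \<ge> real N \<Longrightarrow> dist x0 y \<ge> real N \<Longrightarrow> dist x y < R + 1 \<Longrightarrow>
          cmod ((g \<circ> e) x - (g \<circ> e) y) < \<eta>"
        using higson_function_vanishing[OF higson[OF g] \<eta>] by blast
      \<comment> \<open>The extra \<open>R\<close> keeps the partner \<open>y (r n)\<close> at
        distance at least \<open>N\<close> from \<open>x0\<close>.\<close>
      obtain N' where N': "real N + R \<le> real N'" "N \<le> N'"
        using real_arch_simple[of "max (real N + R) (real N)"] by auto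
      have "cmod (g (e (x (r n))) - g (e (y (r n)))) \<le> \<eta>" if "n \<ge> N'" for n
      proof -
        have "real N' \<le> dist x0 (x (r n))"
          using xy(1)[of "r n"] seq_suble[OF r(1), of n] that by linarith
        moreover then have "real N \<le> dist x0 (y (r n))"
          using xy(2)[of "r n"] N'(1) dist_triangle[of x0 "x (r n)" "y (r n)"]
          by (simp add: dist_commute)
        ultimately show ?thesis
          using N[of "x (r n)" "y (r n)"] xy(2)[of "r n"] N'(2) by simp
      qed
      then have "\<forall>\<^sub>F n in sequentially. cmod (g (e (x (r n))) - g (e (y (r n)))) \<le> \<eta>"
        unfolding eventually_sequentially by blast
      then show ?thesis using tendsto_upperbound[OF lim] by simp
    qed
    then have "cmod (g a - g b) \<le> 0" by (rule field_le_epsilon)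
    then have "D a b \<le> 0" using ab by (simp add: g_def)
    moreover have "\<epsilon> \<le> D a b"
      using tendsto_lowerbound[OF tendsto_D[OF r(2,3)]] xy(3) by simp
    ultimately show False using \<epsilon> by simp
  qed
qed

end

section \<open>The correspondence\<close>

text \<open>The map from the Higson compactification is composed with the homeomorphism. The carrier
  types may differ, since coarseness is established on the completion and needed on Gromov
  points.\<close>

lemma coarse_compactification_equivalent:
  fixes c :: "'b topology \<times> ('a::metric_space \<Rightarrow> 'b)" and c' :: "'d topology \<times> ('a \<Rightarrow> 'd)"
  assumes c: "coarse_compactification c" and eq: "equivalent_compactifications c c'"
  shows "coarse_compactification c'"
proof -
  obtain T e T' e' where cs: "c = (T, e)" "c' = (T', e')" by fastforce
  obtain f where f: "homeomorphic_map T T' f" and fe: "\<And>x. f (e x) = e' x"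
    using eq by (auto simp: cs equivalent_compactifications_def)
  have space: "T homeomorphic_space T'"
    using f by (rule homeomorphic_map_imp_homeomorphic_space)
  have T: "compact_space T" "Hausdorff_space T" "embedding_map euclidean T e"
    "T closure_of range e = topspace T" "metrizable_space T"
    using c by (auto simp: cs coarse_compactification_def compactification_def)
  have e': "e' = f \<circ> e" by (simp add: fun_eq_iff fe)
  have "embedding_map T T' f"
    using f surjective_embedding_map by blast
  then have emb: "embedding_map euclidean T' e'"
    unfolding e' by (rule embedding_map_compose[OF T(3)])
  have "range e \<subseteq> topspace T"
  proof -
    have "continuous_map euclidean T e"
      using T(3) unfolding embedding_map_def
      by (rule continuous_map_into_fulltopology[OF homeomorphic_imp_continuous_map])
    then show ?thesis by (auto simp: continuous_map_def)
  qed
  then have "T' closure_of (f ` range e) = f ` (T closure_of range e)"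
    by (intro homeomorphic_map_closure_of f)
  then have dense: "T' closure_of range e' = topspace T'"
    using T(4) homeomorphic_imp_surjective_map[OF f] by (simp add: e' image_comp)
  obtain H :: "(('a \<Rightarrow> complex) \<Rightarrow> complex) topology" and h k where
    H: "higson_compactification (H, h)" "continuous_map H T k" "\<And>x. k (h x) = e x"
    using c unfolding cs coarse_compactification_def by auto
  have "continuous_map H T' (f \<circ> k)" "\<And>x. (f \<circ> k) (h x) = e' x"
    using continuous_map_compose[OF H(2) homeomorphic_imp_continuous_map[OF f]] H(3) fe by auto
  moreover have "compactification (T', e')"
    using T(1,2) homeomorphic_compact_space[OF space] homeomorphic_Hausdorff_space[OF space] emb dense
    by (simp add: compactification_def)
  moreover have "metrizable_space T'"
    using T(5) homeomorphic_metrizable_space[OF space] by blast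
  ultimately show ?thesis
    using H(1) unfolding cs coarse_compactification_def by blast
qed

locale proper_space =
  fixes x0 :: "'a::metric_space"
  assumes proper: "\<And>S :: 'a set. closed S \<Longrightarrow> bounded S \<Longrightarrow> compact S"
begin

lemma controlled_product_model:
  assumes "p \<in> controlled_products x0"
  obtains M :: "('a \<Rightarrow> real) set" and D e where "metric_compactification M D e"
    "product_compatible p (Metric_space.mtopology M D) e"
    "coarse_compactification (Metric_space.mtopology M D, e)"
    "equivalent_compactifications (Metric_space.mtopology M D, e) (gromov_compactification p)"
proof -
  have p: "controlled_product x0 p" using assms by (simp add: controlled_products_def)
  obtain M :: "('a \<Rightarrow> real) set" and D e where M: "metric_compactification M D e"
    "product_compatible p (Metric_space.mtopology M D) e"
    using controlled_product_imp_compactification[OF proper p] by blast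
  interpret C: metric_compactification M D e by (rule M(1))
  have "CP3 x0 p" "\<And>x y. p x y \<ge> 0" using p by (auto simp: controlled_product_def)
  then have "coarse_compactification (C.mtopology, e)"
    by (rule C.coarse_compactification_if_compatible[OF M(2)])
  with M show ?thesis
    using C.equivalent_gromov_compactification[OF M(2)] that by blast
qed

lemma gromov_compactification_coarse:
  assumes "p \<in> controlled_products x0"
  shows "gromov_compactification p \<in> coarse_compactifications"
proof -
  obtain M :: "('a \<Rightarrow> real) set" and D e where "coarse_compactification (Metric_space.mtopology M D, e)"
    "equivalent_compactifications (Metric_space.mtopology M D, e) (gromov_compactification p)"
    by (rule controlled_product_model[OF assms])
  then show ?thesis
    unfolding coarse_compactifications_def mem_Collect_eq
    by (rule coarse_compactification_equivalent)
qed

text \<open>With \<open>'c\<close> arbitrary, this gives surjectivity on the fixed carrier and also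
  the comparison with compactifications on other types.\<close>

lemma coarse_compactification_gromov_ex:
  fixes c :: "'c topology \<times> ('a \<Rightarrow> 'c)"
  assumes "coarse_compactification c"
  shows "\<exists>p\<in>controlled_products x0. equivalent_compactifications c (gromov_compactification p)"
proof -
  obtain T e where c: "c = (T, e)" by fastforce
  then have T: "compactification (T, e)" "metrizable_space T"
    using assms by (auto simp: coarse_compactification_def)
  then obtain M D where M: "Metric_space M D" "T = Metric_space.mtopology M D"
    unfolding metrizable_space_def by blast
  interpret Metric_space M D by (rule M(1))
  interpret metric_compactification M D e
    by unfold_locales (use proper T(1) M(2) in simp_all)
  interpret slow_metric_compactification M D e x0
  proof
    have "coarse_compactification (mtopology, e)" using assms by (simp add: c M(2))
    then show "\<exists>K. \<forall>x y. K \<le> dist x0 x \<longrightarrow> dist x y \<le> R \<longrightarrow> D (e x) (e y) < \<epsilon>"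
      if "\<epsilon> > 0" for R \<epsilon>
      using that by (rule slow_if_coarse_compactification)
  qed
  have "metric_product \<in> controlled_products x0"
    using controlled_product_metric_product by (simp add: controlled_products_def)
  then show ?thesis
    using equivalent_gromov_compactification[OF product_compatible_metric_product]
    by (auto simp: c M(2))
qed

text \<open>For coarsely equivalent products one metric model serves both. Conversely, an
  equivalence of the compactifications gives a homeomorphism of models that carries compatibility of
  \<open>q\<close> to the model of \<open>p\<close>, where compatible products are coarsely
  equivalent.\<close>

lemma equivalent_gromov_compactifications_iff:
  assumes p: "p \<in> controlled_products x0" and q: "q \<in> controlled_products x0"
  shows "equivalent_compactifications (gromov_compactification p) (gromov_compactification q) \<longleftrightarrow>
    coarsely_equivalent p q"
proof -
  have nonneg: "\<And>x y. p x y \<ge> 0" "\<And>x y. q x y \<ge> 0"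
    using p q by (auto simp: controlled_products_def controlled_product_def)
  obtain M :: "('a \<Rightarrow> real) set" and D e where C: "metric_compactification M D e"
    "product_compatible p (Metric_space.mtopology M D) e"
    "coarse_compactification (Metric_space.mtopology M D, e)"
    "equivalent_compactifications (Metric_space.mtopology M D, e) (gromov_compactification p)"
    by (rule controlled_product_model[OF p])
  interpret C: metric_compactification M D e by (rule C(1))
  have pC: "equivalent_compactifications (gromov_compactification p) (C.mtopology, e)"
    using C.compactification C(4) by (rule equivalent_compactifications_sym)
  show ?thesis
  proof
    assume "coarsely_equivalent p q"
    then have "product_compatible q C.mtopology e"
      by (rule product_compatible_coarsely_equivalent[OF nonneg _ C(2)])
    then show "equivalent_compactifications (gromov_compactification p) (gromov_compactification q)"
      using C.equivalent_gromov_compactification equivalent_compactifications_trans[OF pC] by blast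
  next
    assume eq: "equivalent_compactifications (gromov_compactification p) (gromov_compactification q)"
    obtain M' :: "('a \<Rightarrow> real) set" and D' e' where C': "metric_compactification M' D' e'"
      "product_compatible q (Metric_space.mtopology M' D') e'"
      "equivalent_compactifications (Metric_space.mtopology M' D', e') (gromov_compactification q)"
      by (rule controlled_product_model[OF q])
    interpret C': metric_compactification M' D' e' by (rule C'(1))
    have "compactification (gromov_compactification p)"
      using gromov_compactification_coarse[OF p]
      by (auto simp: coarse_compactifications_def coarse_compactification_def gromov_compactification_def)
    then have "equivalent_compactifications (gromov_compactification q) (gromov_compactification p)"
      using eq by (rule equivalent_compactifications_sym)
    then have "equivalent_compactifications (C'.mtopology, e') (C.mtopology, e)"
      by (rule equivalent_compactifications_trans[OF equivalent_compactifications_trans[OF C'(3)] pC])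
    then obtain f where f: "homeomorphic_map C'.mtopology C.mtopology f" "\<And>x. f (e' x) = e x"
      unfolding equivalent_compactifications_def by auto
    have "product_compatible q C.mtopology e"
      by (rule product_compatible_homeomorphic[OF C'(2) f(1)]) (simp_all add: f(2))
    then show "coarsely_equivalent p q"
      using C(2) nonneg(2) by (intro C.product_compatible_imp_coarsely_equivalent)
  qed
qed

lemma compactification_equiv_rel_gromov_iff:
  assumes "p \<in> controlled_products x0" "q \<in> controlled_products x0"
  shows "compactification_equiv_rel `` {gromov_compactification p} =
      compactification_equiv_rel `` {gromov_compactification q} \<longleftrightarrow> (p, q) \<in> coarse_equiv_rel x0"
proof -
  have coarse: "gromov_compactification p \<in> coarse_compactifications"
    "gromov_compactification q \<in> coarse_compactifications"
    using assms by (simp_all add: gromov_compactification_coarse)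
  have "compactification_equiv_rel `` {gromov_compactification p} =
      compactification_equiv_rel `` {gromov_compactification q} \<longleftrightarrow>
      (gromov_compactification p, gromov_compactification q) \<in> compactification_equiv_rel"
    by (rule eq_equiv_class_iff[OF equiv_compactification_equiv_rel coarse])
  also have "\<dots> \<longleftrightarrow> equivalent_compactifications (gromov_compactification p) (gromov_compactification q)"
    using coarse by (simp add: compactification_equiv_rel_def)
  also have "\<dots> \<longleftrightarrow> coarsely_equivalent p q"
    by (rule equivalent_gromov_compactifications_iff[OF assms])
  also have "\<dots> \<longleftrightarrow> (p, q) \<in> coarse_equiv_rel x0"
    using assms by (simp add: coarse_equiv_rel_def)
  finally show ?thesis .
qed

lemma gromov_class_respects:
  "(\<lambda>p. compactification_equiv_rel `` {gromov_compactification p}) respects coarse_equiv_rel x0"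
proof (rule congruentI)
  fix p q assume pq: "(p, q) \<in> coarse_equiv_rel x0"
  then have "p \<in> controlled_products x0" "q \<in> controlled_products x0"
    by (auto simp: coarse_equiv_rel_def)
  then show "compactification_equiv_rel `` {gromov_compactification p} =
      compactification_equiv_rel `` {gromov_compactification q}"
    using pq compactification_equiv_rel_gromov_iff by blast
qed

lemma bij_betw_gromov_classes:
  "bij_betw (\<lambda>C. \<Union>p\<in>C. compactification_equiv_rel `` {gromov_compactification p})
     (controlled_products x0 // coarse_equiv_rel x0)
     (coarse_compactifications // compactification_equiv_rel)"
proof -
  let ?F = "\<lambda>C. \<Union>p\<in>C. compactification_equiv_rel `` {gromov_compactification p}"
  \<comment> \<open>Well-definedness collapses the union over a class to the value at any
    representative.\<close>
  have F: "?F (coarse_equiv_rel x0 `` {p}) = compactification_equiv_rel `` {gromov_compactification p}"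
    if "p \<in> controlled_products x0" for p
    using UN_equiv_class[OF equiv_coarse_equiv_rel gromov_class_respects that] .
  show ?thesis
    unfolding bij_betw_def
  proof
    show "inj_on ?F (controlled_products x0 // coarse_equiv_rel x0)"
    proof (rule inj_onI)
      fix A B assume A: "A \<in> controlled_products x0 // coarse_equiv_rel x0"
        and B: "B \<in> controlled_products x0 // coarse_equiv_rel x0" and eq: "?F A = ?F B"
      obtain p where p: "p \<in> controlled_products x0" "A = coarse_equiv_rel x0 `` {p}"
        using A by (rule quotientE)
      obtain q where q: "q \<in> controlled_products x0" "B = coarse_equiv_rel x0 `` {q}"
        using B by (rule quotientE)
      have "(p, q) \<in> coarse_equiv_rel x0"
        using eq unfolding p(2) q(2) F[OF p(1)] F[OF q(1)]
          compactification_equiv_rel_gromov_iff[OF p(1) q(1)] .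
      then show "A = B"
        unfolding p(2) q(2) by (rule equiv_class_eq[OF equiv_coarse_equiv_rel])
    qed
    show "?F ` (controlled_products x0 // coarse_equiv_rel x0) =
        coarse_compactifications // compactification_equiv_rel"
    proof (intro equalityI subsetI)
      fix A assume "A \<in> ?F ` (controlled_products x0 // coarse_equiv_rel x0)"
      then obtain p where "p \<in> controlled_products x0" "A = ?F (coarse_equiv_rel x0 `` {p})"
        by (auto elim!: quotientE)
      then show "A \<in> coarse_compactifications // compactification_equiv_rel"
        using F gromov_compactification_coarse by (simp add: quotientI)
    next
      fix A :: "('a gromov_point topology \<times> ('a \<Rightarrow> 'a gromov_point)) set"
      assume "A \<in> coarse_compactifications // compactification_equiv_rel"
      then obtain c where c: "c \<in> coarse_compactifications" "A = compactification_equiv_rel `` {c}"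
        by (rule quotientE)
      then obtain p where p: "p \<in> controlled_products x0"
        "equivalent_compactifications c (gromov_compactification p)"
        using coarse_compactification_gromov_ex[of c] by (auto simp: coarse_compactifications_def)
      then have "(c, gromov_compactification p) \<in> compactification_equiv_rel"
        using c(1) gromov_compactification_coarse by (simp add: compactification_equiv_rel_def)
      then have "A = ?F (coarse_equiv_rel x0 `` {p})"
        unfolding c(2) F[OF p(1)] by (rule equiv_class_eq[OF equiv_compactification_equiv_rel])
      then show "A \<in> ?F ` (controlled_products x0 // coarse_equiv_rel x0)"
        using quotientI[OF p(1)] by (rule image_eqI)
    qed
  qed
qed

end

text \<open>The last conjunct ensures that fixing the carrier type loses no equivalence class of
  coarse compactifications.\<close>

theorem theorem1p12:
  fixes x0 :: "'a::metric_space"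
  assumes proper: "\<And>S :: 'a set. closed S \<Longrightarrow> bounded S \<Longrightarrow> compact S"
  shows
    "(\<forall>p \<in> controlled_products x0. gromov_compactification p \<in> coarse_compactifications) \<and>
     (\<lambda>p. compactification_equiv_rel `` {gromov_compactification p}) respects coarse_equiv_rel x0 \<and>
     bij_betw (\<lambda>C. \<Union>p\<in>C. compactification_equiv_rel `` {gromov_compactification p})
       (controlled_products x0 // coarse_equiv_rel x0)
       (coarse_compactifications // compactification_equiv_rel) \<and>
     (\<forall>c :: 'c topology \<times> ('a \<Rightarrow> 'c). coarse_compactification c \<longrightarrow>
        (\<exists>c' \<in> coarse_compactifications. equivalent_compactifications c c'))"
proof -
  interpret proper_space x0 by unfold_locales (rule proper)
  show ?thesis
  proof (intro conjI gromov_class_respects bij_betw_gromov_classes ballI allI impI)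
    show "gromov_compactification p \<in> coarse_compactifications" if "p \<in> controlled_products x0" for p
      using that by (rule gromov_compactification_coarse)
    show "\<exists>c'\<in>coarse_compactifications. equivalent_compactifications c c'"
      if "coarse_compactification c" for c :: "'c topology \<times> ('a \<Rightarrow> 'c)"
      using coarse_compactification_gromov_ex[OF that] gromov_compactification_coarse by blast
  qed
qed

end
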